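(* Consider a state-dependent discrete memoryless channel $W_{Y,Z|X,S}$ with finite alphabets, i.i.d. state distribution $Q_S$, innocent symbol $x_0$, and non-causal channel state information available only at the transmitter (encoder $(M,S^n)\mapsto X^n$, decoder $Y^n\mapsto\hat M$). Let $\mathcal D$ be the set of joint pmfs $P_{S,U,X,Y,Z}=Q_SP_{U|S}\mathbb 1_{\{X=x(U,S)\}}W_{Y,Z|X,S}$, where $U$ is an auxiliary random variable on a finite alphabet with $|\mathcal U|\le|\mathcal X|+2$ and $x:\mathcal U\times\mathcal S\to\mathcal X$ is deterministic, such that $P_Z=Q_0$ and $\mathbb I(U;Y)>\mathbb I(U;Z)$. Let $\mathcal S=\{R\ge0:\exists P\in\mathcal D\text{ with } R\le\mathbb I(U;Y)-\mathbb I(U;S)\}$. Then the covert capacity satisfies $C_{\mathrm{NC\text{-}T}}\ge\max\{x:x\in\mathcal S\}$.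
   Context: Finite alphabets $\mathcal S,\mathcal X,\mathcal Y,\mathcal Z$. The channel has transition pmf $W_{Y,Z|X,S}$: input $X$, state $S$, output $Y$ at the legitimate receiver and output $Z$ at an adversary (warden). The state sequence $S^n$ is i.i.d. with pmf $Q_S$ and independent of the message; neither the legitimate receiver nor the warden knows the state. $x_0\in\mathcal X$ is a fixed innocent symbol, and $Q_0(z)=\sum_{s}Q_S(s)W_{Z|X,S}(z|x_0,s)$, assumed to have full support on $\mathcal Z$. A $(2^{nR},n)$ code consists of a message $M$ uniform on $\{1,\dots,2^{nR}\}$, an encoder and a decoder of the type specified. $P_{Z^n}$ denotes the distribution of the warden's output induced by the code. A rate $R$ is achievable if there is a sequence of $(2^{nR},n)$ codes with $\mathbb P(\hat M\ne M)\to 0$ and $\mathbb D(P_{Z^n}\|Q_0^{\otimes n})\to 0$ as $n\to\infty$; the covert capacity is the supremum of achievable rates. Mutual informations are computed under the indicated joint pmf.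
   Formalization: The maximum of the rate set need not exist (the set can be empty, e.g. if Y=Z, and it is defined by a strict inequality), so the bound is stated with the supremum of the set in the extended reals, which equals the maximum whenever that exists. *)

theory Defs
  imports "HOL-Probability.Probability"
begin

definition seqs :: "nat \<Rightarrow> 'a list set" where
  "seqs n = {xs. length xs = n}"

definition WY :: "('x \<Rightarrow> 's \<Rightarrow> ('y \<times> 'z) pmf) \<Rightarrow> 'x \<Rightarrow> 's \<Rightarrow> 'y \<Rightarrow> real" where
  "WY W x s y = pmf (map_pmf fst (W x s)) y"

definition WZ :: "('x \<Rightarrow> 's \<Rightarrow> ('y \<times> 'z) pmf) \<Rightarrow> 'x \<Rightarrow> 's \<Rightarrow> 'z \<Rightarrow> real" where
  "WZ W x s z = pmf (map_pmf snd (W x s)) z"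

definition Q0 :: "'s::finite pmf \<Rightarrow> ('x \<Rightarrow> 's \<Rightarrow> ('y \<times> 'z) pmf) \<Rightarrow> 'x \<Rightarrow> 'z \<Rightarrow> real" where
  "Q0 QS W x0 z = (\<Sum>s\<in>UNIV. pmf QS s * WZ W x0 s z)"

definition state_prob :: "'s pmf \<Rightarrow> 's list \<Rightarrow> real" where
  "state_prob QS ss = (\<Prod>i<length ss. pmf QS (ss ! i))"

definition chanY :: "('x \<Rightarrow> 's \<Rightarrow> ('y \<times> 'z) pmf) \<Rightarrow> 'x list \<Rightarrow> 's list \<Rightarrow> 'y list \<Rightarrow> real" where
  "chanY W xs ss ys = (\<Prod>i<length ys. WY W (xs ! i) (ss ! i) (ys ! i))"

definition chanZ :: "('x \<Rightarrow> 's \<Rightarrow> ('y \<times> 'z) pmf) \<Rightarrow> 'x list \<Rightarrow> 's list \<Rightarrow> 'z list \<Rightarrow> real" where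
  "chanZ W xs ss zs = (\<Prod>i<length zs. WZ W (xs ! i) (ss ! i) (zs ! i))"

definition num_msgs :: "nat \<Rightarrow> real \<Rightarrow> nat" where
  "num_msgs n R = nat \<lceil>2 powr (real n * R)\<rceil>"

text \<open>A (2^{nR},n) code with non-causal state information at the transmitter:
  encoder (m, s^n) |-> x^n (must produce a length-n word), decoder y^n |-> m-hat.
  Messages are 1..num_msgs n R.\<close>
definition valid_code :: "nat \<Rightarrow> real \<Rightarrow> (nat \<Rightarrow> 's list \<Rightarrow> 'x list) \<Rightarrow> bool" where
  "valid_code n R enc \<longleftrightarrow>
     (\<forall>m\<in>{1..num_msgs n R}. \<forall>ss\<in>seqs n. length (enc m ss) = n)"

definition error_prob ::
  "'s::finite pmf \<Rightarrow> ('x \<Rightarrow> 's \<Rightarrow> ('y::finite \<times> 'z) pmf) \<Rightarrow> nat \<Rightarrow> real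
   \<Rightarrow> (nat \<Rightarrow> 's list \<Rightarrow> 'x list) \<Rightarrow> ('y list \<Rightarrow> nat) \<Rightarrow> real" where
  "error_prob QS W n R enc dec =
     (1 / real (num_msgs n R)) *
     (\<Sum>m\<in>{1..num_msgs n R}. \<Sum>ss\<in>seqs n. \<Sum>ys\<in>seqs n.
        state_prob QS ss * chanY W (enc m ss) ss ys * (if dec ys \<noteq> m then 1 else 0))"

definition warden_dist ::
  "'s::finite pmf \<Rightarrow> ('x \<Rightarrow> 's \<Rightarrow> ('y \<times> 'z) pmf) \<Rightarrow> nat \<Rightarrow> real
   \<Rightarrow> (nat \<Rightarrow> 's list \<Rightarrow> 'x list) \<Rightarrow> 'z list \<Rightarrow> real" where
  "warden_dist QS W n R enc zs =
     (1 / real (num_msgs n R)) *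
     (\<Sum>m\<in>{1..num_msgs n R}. \<Sum>ss\<in>seqs n. state_prob QS ss * chanZ W (enc m ss) ss zs)"

definition Q0n :: "'s::finite pmf \<Rightarrow> ('x \<Rightarrow> 's \<Rightarrow> ('y \<times> 'z) pmf) \<Rightarrow> 'x \<Rightarrow> 'z list \<Rightarrow> real" where
  "Q0n QS W x0 zs = (\<Prod>i<length zs. Q0 QS W x0 (zs ! i))"

text \<open>Relative entropy D(P||Q) on length-n sequences (Q has full support here),
  with the convention 0 log 0 = 0.\<close>
definition KL_seq :: "nat \<Rightarrow> ('a list \<Rightarrow> real) \<Rightarrow> ('a list \<Rightarrow> real) \<Rightarrow> real" where
  "KL_seq n P Q = (\<Sum>zs\<in>seqs n. if P zs = 0 then 0 else P zs * log 2 (P zs / Q zs))"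

definition achievable ::
  "'s::finite pmf \<Rightarrow> ('x \<Rightarrow> 's \<Rightarrow> ('y::finite \<times> 'z::finite) pmf) \<Rightarrow> 'x \<Rightarrow> real \<Rightarrow> bool" where
  "achievable QS W x0 R \<longleftrightarrow>
     (\<exists>enc :: nat \<Rightarrow> nat \<Rightarrow> 's list \<Rightarrow> 'x list. \<exists>dec :: nat \<Rightarrow> 'y list \<Rightarrow> nat.
        (\<forall>n. valid_code n R (enc n)) \<and>
        (\<lambda>n. error_prob QS W n R (enc n) (dec n)) \<longlonglongrightarrow> 0 \<and>
        (\<lambda>n. KL_seq n (warden_dist QS W n R (enc n)) (Q0n QS W x0)) \<longlonglongrightarrow> 0)"

definition covert_capacity ::
  "'s::finite pmf \<Rightarrow> ('x \<Rightarrow> 's \<Rightarrow> ('y::finite \<times> 'z::finite) pmf) \<Rightarrow> 'x \<Rightarrow> ereal" where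
  "covert_capacity QS W x0 = Sup (ereal ` {R. achievable QS W x0 R})"

definition mutual_info :: "('a \<times> 'b) pmf \<Rightarrow> real" where
  "mutual_info p = (\<Sum>ab\<in>set_pmf p.
      pmf p ab * log 2 (pmf p ab / (pmf (map_pmf fst p) (fst ab) * pmf (map_pmf snd p) (snd ab))))"

text \<open>Joint law P_{S,U,X,Y,Z} = Q_S P_{U|S} 1{X = x(U,S)} W_{Y,Z|X,S}; the auxiliary
  alphabet is {0..<|X|+2} (subset of nat).\<close>
definition joint_SUXYZ ::
  "'s pmf \<Rightarrow> ('x \<Rightarrow> 's \<Rightarrow> ('y \<times> 'z) pmf) \<Rightarrow> ('s \<Rightarrow> nat pmf) \<Rightarrow> (nat \<Rightarrow> 's \<Rightarrow> 'x)
   \<Rightarrow> ('s \<times> nat \<times> 'x \<times> 'y \<times> 'z) pmf" where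
  "joint_SUXYZ QS W PU xf =
     do { s \<leftarrow> QS; u \<leftarrow> PU s; yz \<leftarrow> W (xf u s) s;
          return_pmf (s, u, xf u s, fst yz, snd yz) }"

definition I_UY where
  "I_UY QS W PU xf = mutual_info (map_pmf (\<lambda>(s,u,x,y,z). (u,y)) (joint_SUXYZ QS W PU xf))"
definition I_UZ where
  "I_UZ QS W PU xf = mutual_info (map_pmf (\<lambda>(s,u,x,y,z). (u,z)) (joint_SUXYZ QS W PU xf))"
definition I_US where
  "I_US QS W PU xf = mutual_info (map_pmf (\<lambda>(s,u,x,y,z). (u,s)) (joint_SUXYZ QS W PU xf))"

text \<open>The set \<D>, represented by its parameters (P_{U|S}, x).\<close>
definition in_D ::
  "'s::finite pmf \<Rightarrow> ('x::finite \<Rightarrow> 's \<Rightarrow> ('y \<times> 'z) pmf) \<Rightarrow> 'x \<Rightarrow> ('s \<Rightarrow> nat pmf) \<Rightarrow> (nat \<Rightarrow> 's \<Rightarrow> 'x) \<Rightarrow> bool" where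
  "in_D QS W x0 PU xf \<longleftrightarrow>
     (\<forall>s. set_pmf (PU s) \<subseteq> {..<CARD('x) + 2}) \<and>
     (\<forall>z. pmf (map_pmf (\<lambda>(s,u,x,y,z). z) (joint_SUXYZ QS W PU xf)) z = Q0 QS W x0 z) \<and>
     I_UY QS W PU xf > I_UZ QS W PU xf"

definition rate_set ::
  "'s::finite pmf \<Rightarrow> ('x::finite \<Rightarrow> 's \<Rightarrow> ('y \<times> 'z) pmf) \<Rightarrow> 'x \<Rightarrow> real set" where
  "rate_set QS W x0 = {R. R \<ge> 0 \<and> (\<exists>PU xf. in_D QS W x0 PU xf \<and>
                             R \<le> I_UY QS W PU xf - I_US QS W PU xf)}"

end

theory Submission
  imports Defs
begin

text \<open>
  Draw codewords \<open>u(m, j)\<close>, with \<open>j\<close> ranging over about \<open>2 ^ (n I(U;S))\<close> indices, independently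
  from \<open>P_U\<close>. In the ideal experiment \<open>(m, j)\<close> is uniform and the state is produced by
  \<open>P_{S|U}\<close> applied to \<open>u(m, j)\<close>; there, decoding is ordinary channel coding over
  \<open>P_{Y|U}\<close> at a rate just below \<open>I(U;Y)\<close>, and since that rate exceeds \<open>I(U;Z)\<close> the warden's
  output is close to its i.i.d. law by soft covering. The likelihood encoder picks \<open>j\<close> from the
  ideal posterior given \<open>(m, s)\<close>, so by soft covering of the state at a rate above \<open>I(U;S)\<close> the
  true experiment is close to the ideal one. Encoders must be deterministic, so the choice of
  \<open>j\<close> is sampled once for each pair \<open>(m, s)\<close>; the fluctuation this causes at the warden is
  controlled because \<open>I(U;Z) - I(U;S)\<close> is smaller than the message rate. All three covering
  steps follow from one truncated second moment bound for sums of independent terms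
  (\<open>E_abs_dev\<close>). The total variation distance decays exponentially, hence so does the
  divergence, as the logarithm of the likelihood ratio is at most linear in \<open>n\<close>.
\<close>

section \<open>Expectations over finite product distributions\<close>

text \<open>Reliability, state matching and covertness must hold for one and the same deterministic
  code. Each is therefore measured by a nonnegative quantity, and only their sum is averaged, over
  codebooks and over selections of \<open>j\<close>; an outcome not above the mean serves all at
  once. With slack \<open>\<gamma>\<close> the index rate is \<open>I(U;S) + 2\<gamma>\<close> and
  the message rate \<open>I(U;Y) - I(U;S) - 4\<gamma>\<close>. The sum is just below
  \<open>I(U;Y)\<close>, and the gap \<open>I(U;Y) > I(U;Z)\<close> pays for both warden estimates.
  The tighter one is the selection: once \<open>j\<close> is fixed, a pair \<open>(m, s)\<close>
  puts the atom \<open>Q_S(s) P(z|u,s) / M\<close> on \<open>z\<close>, and the sum concentrates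
  only if such atoms are small against \<open>P_Z(z)\<close>. The factor \<open>Q_S(s)\<close> is
  what helps: the state does part of the averaging, so \<open>M\<close> alone, without the index
  rate, suffices. Decoding and covering are proved for arbitrary finite alphabets with explicit
  thresholds; words of length \<open>n\<close> are just another alphabet, and only the threshold
  events need asymptotics.\<close>

locale finite_product =
  fixes I :: "'i set" and A :: "'i \<Rightarrow> 'a set" and p :: "'i \<Rightarrow> 'a \<Rightarrow> real"
  assumes fin_I: "finite I" and fin_A: "\<And>i. i \<in> I \<Longrightarrow> finite (A i)"
    and p_nonneg: "\<And>i a. i \<in> I \<Longrightarrow> a \<in> A i \<Longrightarrow> 0 \<le> p i a"
    and p_sum: "\<And>i. i \<in> I \<Longrightarrow> (\<Sum>a\<in>A i. p i a) = 1"
begin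

text \<open>Expectation when the coordinates \<open>c i\<close> are independent with laws
  \<open>p i\<close>. The laws may differ from coordinate to coordinate: codewords are identically
  distributed, but the selected indices are not.\<close>

definition E :: "(('i \<Rightarrow> 'a) \<Rightarrow> real) \<Rightarrow> real" where
  "E F = (\<Sum>c\<in>PiE I A. (\<Prod>i\<in>I. p i (c i)) * F c)"

definition mean :: "'i \<Rightarrow> ('a \<Rightarrow> real) \<Rightarrow> real" where
  "mean i g = (\<Sum>a\<in>A i. p i a * g a)"

lemma weight_nonneg: "c \<in> PiE I A \<Longrightarrow> 0 \<le> (\<Prod>i\<in>I. p i (c i))"
  by (intro prod_nonneg ballI p_nonneg) (auto simp: PiE_iff)

lemma E_prod: "E (\<lambda>c. \<Prod>i\<in>I. g i (c i)) = (\<Prod>i\<in>I. mean i (g i))"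
  unfolding E_def mean_def by (subst prod_sum_PiE) (auto simp: fin_I fin_A prod.distrib)

lemma E_const: "E (\<lambda>_. k) = k"
proof -
  have "E (\<lambda>_. 1) = 1"
    using E_prod[of "\<lambda>_ _. 1"] by (simp add: mean_def p_sum)
  then show ?thesis
    unfolding E_def by (simp add: sum_distrib_right[symmetric])
qed

lemma E_add: "E (\<lambda>c. F c + G c) = E F + E G"
  unfolding E_def by (simp add: sum.distrib algebra_simps)

lemma E_cmult: "E (\<lambda>c. k * F c) = k * E F"
  unfolding E_def by (simp add: sum_distrib_left algebra_simps)

lemma E_sum: "E (\<lambda>c. \<Sum>k\<in>K. F k c) = (\<Sum>k\<in>K. E (F k))"
  unfolding E_def by (simp add: sum_distrib_left) (rule sum.swap)

lemma E_mono: "(\<And>c. c \<in> PiE I A \<Longrightarrow> F c \<le> G c) \<Longrightarrow> E F \<le> E G"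
  unfolding E_def by (intro sum_mono mult_left_mono weight_nonneg)

lemma E_exists: "\<exists>c\<in>PiE I A. F c \<le> E F"
proof (rule ccontr)
  assume "\<not> ?thesis"
  then have less: "E F < F c" if "c \<in> PiE I A" for c using that by (auto simp: not_le)
  have one: "(\<Sum>c\<in>PiE I A. (\<Prod>i\<in>I. p i (c i))) = 1"
    using E_const[of 1] by (simp add: E_def)
  \<comment> \<open>If every value exceeded the mean, strictness of the averaged inequality would
    still require a point of positive weight; total weight one supplies it.\<close>
  then obtain c0 where c0: "c0 \<in> PiE I A" "(\<Prod>i\<in>I. p i (c0 i)) \<noteq> 0"
    by (metis (mono_tags, lifting) sum.neutral zero_neq_one)
  then have pos: "(\<Prod>i\<in>I. p i (c0 i)) > 0" using weight_nonneg[of c0] by simp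
  have "(\<Sum>c\<in>PiE I A. (\<Prod>i\<in>I. p i (c i)) * E F) < E F"
    unfolding E_def[of F]
    using less c0 pos
    by (intro sum_strict_mono_ex1 ballI bexI[of _ c0])
       (auto intro!: mult_left_mono weight_nonneg finite_PiE fin_I fin_A simp: less_imp_le simp flip: E_def)
  then show False by (simp add: one flip: sum_distrib_right)
qed

text \<open>A function of one coordinate is a product whose other factors are 1, and those factors
  have mean 1; \<open>E_pair\<close> uses the same device with two coordinates.\<close>

lemma E_single:
  assumes "i \<in> I"
  shows "E (\<lambda>c. g (c i)) = mean i g"
proof -
  have *: "(\<Prod>k\<in>I. if k = i then h k else 1) = h i" for h :: "'i \<Rightarrow> real"
    using assms by (simp add: fin_I prod.delta)
  have "E (\<lambda>c. g (c i)) = E (\<lambda>c. \<Prod>k\<in>I. (if k = i then g (c k) else 1))"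
    by (simp add: *[of "\<lambda>k. g (_ k)"])
  also have "\<dots> = (\<Prod>k\<in>I. mean k (\<lambda>a. if k = i then g a else 1))"
    by (rule E_prod)
  also have "\<dots> = (\<Prod>k\<in>I. if k = i then mean k g else 1)"
    by (intro prod.cong) (auto simp: mean_def p_sum)
  finally show ?thesis by (simp add: *)
qed

lemma E_pair:
  assumes "i \<in> I" "j \<in> I" "i \<noteq> j"
  shows "E (\<lambda>c. g (c i) * h (c j)) = mean i g * mean j h"
proof -
  have *: "(\<Prod>k\<in>I. if k = i then f k else if k = j then f' k else 1) = f i * f' j"
    for f f' :: "'i \<Rightarrow> real"
  proof -
    have "(\<Prod>k\<in>I. if k = i then f k else if k = j then f' k else 1)
        = (\<Prod>k\<in>I. (if k = i then f k else 1) * (if k = j then f' k else 1))"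
      using assms by (intro prod.cong) auto
    then show ?thesis using assms by (simp add: prod.distrib fin_I prod.delta)
  qed
  have "E (\<lambda>c. g (c i) * h (c j))
      = E (\<lambda>c. \<Prod>k\<in>I. (if k = i then g (c k) else if k = j then h (c k) else 1))"
    by (simp add: *[of "\<lambda>k. g (_ k)" "\<lambda>k. h (_ k)"])
  also have "\<dots> = (\<Prod>k\<in>I. mean k (\<lambda>a. if k = i then g a else if k = j then h a else 1))"
    by (rule E_prod)
  also have "\<dots> = (\<Prod>k\<in>I. if k = i then mean k g else if k = j then mean k h else 1)"
    by (intro prod.cong) (auto simp: mean_def p_sum)
  finally show ?thesis by (simp add: *)
qed

lemma mean_nonneg: "i \<in> I \<Longrightarrow> (\<And>a. a \<in> A i \<Longrightarrow> 0 \<le> g a) \<Longrightarrow> 0 \<le> mean i g"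
  unfolding mean_def by (intro sum_nonneg mult_nonneg_nonneg p_nonneg)

lemma mean_mono: "i \<in> I \<Longrightarrow> (\<And>a. a \<in> A i \<Longrightarrow> g a \<le> h a) \<Longrightarrow> mean i g \<le> mean i h"
  unfolding mean_def by (intro sum_mono mult_left_mono p_nonneg)

text \<open>After centring, independence kills the off-diagonal products, so variances add; each
  variance is at most the raw second moment.\<close>

lemma E_square_dev:
  assumes K: "K \<subseteq> I"
  shows "E (\<lambda>c. ((\<Sum>i\<in>K. f i (c i)) - (\<Sum>i\<in>K. mean i (f i)))\<^sup>2) \<le> (\<Sum>i\<in>K. mean i (\<lambda>a. (f i a)\<^sup>2))"
proof -
  define h where "h i a = f i a - mean i (f i)" for i a
  have finK: "finite K" using K fin_I by (rule finite_subset)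
  have h0: "mean i (h i) = 0" if "i \<in> I" for i
    using that p_sum[of i]
    by (simp add: h_def mean_def right_diff_distrib sum_subtractf flip: sum_distrib_right)
  have h2: "mean i (\<lambda>a. (h i a)\<^sup>2) \<le> mean i (\<lambda>a. (f i a)\<^sup>2)" if "i \<in> I" for i
  proof -
    define m where "m = mean i (f i)"
    have "mean i (\<lambda>a. (h i a)\<^sup>2) = (\<Sum>a\<in>A i. p i a * (f i a)\<^sup>2 - 2 * m * (p i a * f i a) + m\<^sup>2 * p i a)"
      unfolding mean_def h_def m_def[symmetric, unfolded mean_def]
      by (intro sum.cong) (auto simp: power2_eq_square algebra_simps)
    also have "\<dots> = mean i (\<lambda>a. (f i a)\<^sup>2) - 2 * m * m + m\<^sup>2 * 1"
      unfolding sum.distrib sum_subtractf sum_distrib_left[symmetric]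
      by (simp add: p_sum[OF that] m_def mean_def)
    finally show ?thesis by (simp add: power2_eq_square)
  qed
  have "E (\<lambda>c. ((\<Sum>i\<in>K. f i (c i)) - (\<Sum>i\<in>K. mean i (f i)))\<^sup>2)
      = E (\<lambda>c. \<Sum>i\<in>K. \<Sum>j\<in>K. h i (c i) * h j (c j))"
    by (simp add: h_def power2_eq_square sum_product flip: sum_subtractf)
  also have "\<dots> = (\<Sum>i\<in>K. \<Sum>j\<in>K. E (\<lambda>c. h i (c i) * h j (c j)))"
    by (simp add: E_sum)
  also have "\<dots> = (\<Sum>i\<in>K. \<Sum>j\<in>K. if j = i then mean i (\<lambda>a. (h i a)\<^sup>2) else 0)"
  proof (intro sum.cong refl)
    fix i j assume "i \<in> K" "j \<in> K"
    then have ij: "i \<in> I" "j \<in> I" using K by auto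
    show "E (\<lambda>c. h i (c i) * h j (c j)) = (if j = i then mean i (\<lambda>a. (h i a)\<^sup>2) else 0)"
      using E_single[OF ij(1), of "\<lambda>a. (h i a)\<^sup>2"] E_pair[OF ij, of "h i" "h j"] h0[OF ij(1)]
      by (auto simp: power2_eq_square)
  qed
  also have "\<dots> = (\<Sum>i\<in>K. mean i (\<lambda>a. (h i a)\<^sup>2))"
    using finK by (simp add: sum.delta')
  also have "\<dots> \<le> (\<Sum>i\<in>K. mean i (\<lambda>a. (f i a)\<^sup>2))"
    using K h2 by (intro sum_mono) auto
  finally show ?thesis .
qed

text \<open>Terms above \<open>t * Q\<close> are charged by their mean alone, the rest by the second
  moment, which is at most \<open>t * Q\<close> times the mean. The level \<open>Q\<close> may
  differ from the mean of the sum, as in the selection of indices, and may vanish, as for states of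
  probability zero. The bound is linear in \<open>Q\<close> and in the mean, so summing it over all
  outcomes of a probability law leaves just \<open>sqrt t\<close>.\<close>

lemma E_abs_dev:
  assumes K: "K \<subseteq> I" and f: "\<And>i a. i \<in> K \<Longrightarrow> a \<in> A i \<Longrightarrow> 0 \<le> f i a"
    and Q: "0 \<le> Q" "Q = 0 \<Longrightarrow> (\<Sum>i\<in>K. mean i (f i)) = 0" and t: "t > 0"
  shows "E (\<lambda>c. \<bar>(\<Sum>i\<in>K. f i (c i)) - (\<Sum>i\<in>K. mean i (f i))\<bar>)
       \<le> 2 * (\<Sum>i\<in>K. mean i (\<lambda>a. f i a * of_bool (f i a > t * Q)))
         + sqrt t * (Q + (\<Sum>i\<in>K. mean i (f i))) / 2"
proof -
  define g where "g i a = f i a * of_bool (f i a > t * Q)" for i a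
  define h where "h i a = f i a * of_bool (f i a \<le> t * Q)" for i a
  define X where "X k c = (\<Sum>i\<in>K. k i (c i))" for k :: "'i \<Rightarrow> 'a \<Rightarrow> real" and c
  define m where "m k = (\<Sum>i\<in>K. mean i (k i))" for k :: "'i \<Rightarrow> 'a \<Rightarrow> real"
  have EX: "E (X k) = m k" for k
    unfolding X_def m_def E_sum using K by (intro sum.cong refl E_single) auto
  have fgh: "f i a = g i a + h i a" for i a by (auto simp: g_def h_def)
  have g0: "0 \<le> g i a" if "i \<in> K" "a \<in> A i" for i a using f[OF that] by (simp add: g_def)
  have h0: "0 \<le> h i a" if "i \<in> K" "a \<in> A i" for i a using f[OF that] by (simp add: h_def)
  have X0: "0 \<le> X k c" if "c \<in> PiE I A" "\<And>i a. i \<in> K \<Longrightarrow> a \<in> A i \<Longrightarrow> 0 \<le> k i a" for k c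
    unfolding X_def using that K by (intro sum_nonneg that(2)) (auto simp: PiE_iff)
  have m0: "0 \<le> m k" if "\<And>i a. i \<in> K \<Longrightarrow> a \<in> A i \<Longrightarrow> 0 \<le> k i a" for k
    unfolding m_def using that K by (intro sum_nonneg mean_nonneg that) auto
  have Xf: "X f c = X g c + X h c" for c by (simp add: X_def fgh sum.distrib)
  have mf: "m f = m g + m h"
    by (simp add: m_def mean_def fgh sum.distrib distrib_left)
  \<comment> \<open>The large part is not centred: \<open>X g\<close> and \<open>m g\<close> are
    nonnegative and have equal means, hence the factor 2 in the bound.\<close>
  have split: "E (\<lambda>c. \<bar>X f c - m f\<bar>) \<le> E (\<lambda>c. (X g c + m g) + \<bar>X h c - m h\<bar>)"
  proof (rule E_mono)
    fix c assume c: "c \<in> PiE I A"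
    show "\<bar>X f c - m f\<bar> \<le> (X g c + m g) + \<bar>X h c - m h\<bar>"
      using X0[OF c, of g] m0[of g] g0 Xf[of c] mf by force
  qed
  have "E (\<lambda>c. \<bar>X h c - m h\<bar>) \<le> sqrt t * (Q + m f) / 2"
  proof (cases "Q = 0")
    case True
    have "h i a = 0" if "i \<in> K" "a \<in> A i" for i a
      using f[OF that] True by (auto simp: h_def)
    then have "m h = 0" "E (\<lambda>c. \<bar>X h c - m h\<bar>) \<le> E (\<lambda>c. 0)"
      subgoal by (simp add: m_def mean_def)
      subgoal
      proof (intro E_mono)
        fix c assume "c \<in> PiE I A"
        then have "X h c = 0" "m h = 0"
          using \<open>\<And>i a. i \<in> K \<Longrightarrow> a \<in> A i \<Longrightarrow> h i a = 0\<close> K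
          by (auto simp: X_def m_def mean_def PiE_iff intro!: sum.neutral)
        then show "\<bar>X h c - m h\<bar> \<le> 0" by simp
      qed
      done
    then show ?thesis using Q True t by (simp add: E_const m_def)
  next
    case False
    \<comment> \<open>The value of \<open>l\<close> that balances
      \<open>x^2 / (2 l) + l / 2\<close>: with second moment at most \<open>t * Q * m f\<close> both
      summands become multiples of \<open>sqrt t\<close>, linear in \<open>m f\<close> and
      \<open>Q\<close>.\<close>
    define l where "l = sqrt t * Q"
    have l: "l > 0" using False Q t by (simp add: l_def)
    have sq: "E (\<lambda>c. (X h c - m h)\<^sup>2) \<le> t * Q * m f"
    proof -
      have "E (\<lambda>c. (X h c - m h)\<^sup>2) \<le> (\<Sum>i\<in>K. mean i (\<lambda>a. (h i a)\<^sup>2))"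
        unfolding X_def m_def by (rule E_square_dev[OF K])
      also have "\<dots> \<le> (\<Sum>i\<in>K. mean i (\<lambda>a. t * Q * f i a))"
        using K f Q(1) t by (intro sum_mono mean_mono)
          (auto simp: h_def power2_eq_square intro!: mult_right_mono)
      also have "\<dots> = t * Q * m f"
        by (simp add: m_def mean_def sum_distrib_left algebra_simps)
      finally show ?thesis .
    qed
    have amgm: "\<bar>x\<bar> \<le> 1 / (2 * l) * x\<^sup>2 + l / 2" for x
    proof -
      have "0 \<le> (\<bar>x\<bar> - l)\<^sup>2" by simp
      then have "2 * l * \<bar>x\<bar> \<le> x\<^sup>2 + l\<^sup>2" by (simp add: power2_eq_square algebra_simps)
      then show ?thesis using l by (simp add: field_simps power2_eq_square)
    qed
    have "E (\<lambda>c. \<bar>X h c - m h\<bar>) \<le> E (\<lambda>c. 1 / (2 * l) * (X h c - m h)\<^sup>2 + l / 2)"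
      by (intro E_mono amgm)
    also have "\<dots> = 1 / (2 * l) * E (\<lambda>c. (X h c - m h)\<^sup>2) + l / 2"
      by (simp only: E_add E_cmult E_const)
    also have "\<dots> \<le> 1 / (2 * l) * (t * Q * m f) + l / 2"
      using l by (intro add_right_mono mult_left_mono sq) auto
    also have "1 / (2 * l) * (t * Q * m f) = sqrt t * m f / 2"
      using False t by (simp add: l_def field_simps)
    finally show ?thesis by (simp add: l_def field_simps)
  qed
  moreover have "E (\<lambda>c. (X g c + m g) + \<bar>X h c - m h\<bar>) = 2 * m g + E (\<lambda>c. \<bar>X h c - m h\<bar>)"
    by (simp only: E_add E_const EX)
  ultimately have "E (\<lambda>c. \<bar>X f c - m f\<bar>) \<le> 2 * m g + sqrt t * (Q + m f) / 2"
    using split by linarith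
  then show ?thesis
    unfolding X_def m_def g_def .
qed

end

section \<open>One-shot coding\<close>

text \<open>
  Here \<open>p\<close> is \<open>P_U\<close>, \<open>v\<close> is \<open>P_{S|U}\<close>, \<open>q\<close> is \<open>Q_S\<close>, \<open>VY\<close> and \<open>VZ\<close> are
  \<open>P_{Y|U}\<close> and \<open>P_{Z|U}\<close>, and \<open>wy u s\<close>, \<open>wz u s\<close> are the channel laws at input
  \<open>x(u, s)\<close> and state \<open>s\<close>.
\<close>

locale channel_model =
  fixes US :: "'u set" and SS :: "'s set" and YS :: "'y set" and ZS :: "'z set"
    and p :: "'u \<Rightarrow> real" and v :: "'u \<Rightarrow> 's \<Rightarrow> real"
    and wy :: "'u \<Rightarrow> 's \<Rightarrow> 'y \<Rightarrow> real" and wz :: "'u \<Rightarrow> 's \<Rightarrow> 'z \<Rightarrow> real"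
    and q :: "'s \<Rightarrow> real" and VY :: "'u \<Rightarrow> 'y \<Rightarrow> real" and VZ :: "'u \<Rightarrow> 'z \<Rightarrow> real"
    and PY :: "'y \<Rightarrow> real" and PZ :: "'z \<Rightarrow> real"
  assumes fin: "finite US" "finite SS" "finite YS" "finite ZS"
    and p0: "\<And>u. u \<in> US \<Longrightarrow> 0 \<le> p u" and p1: "(\<Sum>u\<in>US. p u) = 1"
    and v0: "\<And>u s. u \<in> US \<Longrightarrow> s \<in> SS \<Longrightarrow> 0 \<le> v u s"
    and v1: "\<And>u. u \<in> US \<Longrightarrow> (\<Sum>s\<in>SS. v u s) = 1"
    and wy0: "\<And>u s y. u \<in> US \<Longrightarrow> s \<in> SS \<Longrightarrow> y \<in> YS \<Longrightarrow> 0 \<le> wy u s y"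
    and wy1: "\<And>u s. u \<in> US \<Longrightarrow> s \<in> SS \<Longrightarrow> (\<Sum>y\<in>YS. wy u s y) = 1"
    and wz0: "\<And>u s z. u \<in> US \<Longrightarrow> s \<in> SS \<Longrightarrow> z \<in> ZS \<Longrightarrow> 0 \<le> wz u s z"
    and wz1: "\<And>u s. u \<in> US \<Longrightarrow> s \<in> SS \<Longrightarrow> (\<Sum>z\<in>ZS. wz u s z) = 1"
    and q_eq: "\<And>s. s \<in> SS \<Longrightarrow> q s = (\<Sum>u\<in>US. p u * v u s)"
    and VY_eq: "\<And>u y. u \<in> US \<Longrightarrow> y \<in> YS \<Longrightarrow> VY u y = (\<Sum>s\<in>SS. v u s * wy u s y)"
    and VZ_eq: "\<And>u z. u \<in> US \<Longrightarrow> z \<in> ZS \<Longrightarrow> VZ u z = (\<Sum>s\<in>SS. v u s * wz u s z)"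
    and PY_eq: "\<And>y. y \<in> YS \<Longrightarrow> PY y = (\<Sum>u\<in>US. p u * VY u y)"
    and PZ_eq: "\<And>z. z \<in> ZS \<Longrightarrow> PZ z = (\<Sum>u\<in>US. p u * VZ u z)"
    and PZ_pos: "\<And>z. z \<in> ZS \<Longrightarrow> 0 < PZ z"
begin

lemma VY0: "u \<in> US \<Longrightarrow> y \<in> YS \<Longrightarrow> 0 \<le> VY u y"
  by (simp add: VY_eq sum_nonneg v0 wy0)

lemma VZ0: "u \<in> US \<Longrightarrow> z \<in> ZS \<Longrightarrow> 0 \<le> VZ u z"
  by (simp add: VZ_eq sum_nonneg v0 wz0)

lemma q0: "s \<in> SS \<Longrightarrow> 0 \<le> q s"
  by (simp add: q_eq sum_nonneg v0 p0)

lemma q1: "(\<Sum>s\<in>SS. q s) = 1"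
proof -
  have "(\<Sum>s\<in>SS. q s) = (\<Sum>u\<in>US. \<Sum>s\<in>SS. p u * v u s)"
    by (simp add: q_eq) (rule sum.swap)
  then show ?thesis by (simp add: v1 p1 flip: sum_distrib_left)
qed

lemma VY1: "u \<in> US \<Longrightarrow> (\<Sum>y\<in>YS. VY u y) = 1"
proof -
  assume u: "u \<in> US"
  have "(\<Sum>y\<in>YS. VY u y) = (\<Sum>s\<in>SS. \<Sum>y\<in>YS. v u s * wy u s y)"
    using u by (simp add: VY_eq) (rule sum.swap)
  then show ?thesis using u by (simp add: v1 wy1 flip: sum_distrib_left)
qed

lemma VZ1: "u \<in> US \<Longrightarrow> (\<Sum>z\<in>ZS. VZ u z) = 1"
proof -
  assume u: "u \<in> US"
  have "(\<Sum>z\<in>ZS. VZ u z) = (\<Sum>s\<in>SS. \<Sum>z\<in>ZS. v u s * wz u s z)"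
    using u by (simp add: VZ_eq) (rule sum.swap)
  then show ?thesis using u by (simp add: v1 wz1 flip: sum_distrib_left)
qed

lemma PZ1: "(\<Sum>z\<in>ZS. PZ z) = 1"
proof -
  have "(\<Sum>z\<in>ZS. PZ z) = (\<Sum>u\<in>US. \<Sum>z\<in>ZS. p u * VZ u z)"
    by (simp add: PZ_eq) (rule sum.swap)
  then show ?thesis by (simp add: VZ1 p1 flip: sum_distrib_left)
qed

lemma PY0: "y \<in> YS \<Longrightarrow> 0 \<le> PY y"
  by (simp add: PY_eq sum_nonneg VY0 p0)

end

text \<open>
  The codebook is indexed by \<open>Msgs \<times> Idxs\<close>; \<open>\<tau>\<close> is the threshold of the decoder and
  \<open>\<theta>\<close> the truncation level of the covering arguments.
\<close>

locale one_shot_coding = channel_model US SS YS ZS p v wy wz q VY VZ PY PZ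
  for US :: "'u set" and SS :: "'s set" and YS :: "'y set" and ZS :: "'z set"
    and p v wy wz q VY VZ PY PZ +
  fixes Msgs :: "'m set" and Idxs :: "'j set" and M J \<tau> \<theta> :: real
  assumes card_Msgs: "real (card Msgs) = M" and card_Idxs: "real (card Idxs) = J"
    and M: "0 < M" and J: "0 < J" and \<tau>: "0 < \<tau>" and \<theta>: "0 < \<theta>"
begin

section \<open>Threshold decoding and soft covering in the ideal experiment\<close>

lemma fin_idx: "finite Msgs" "finite Idxs"
  using card_Msgs card_Idxs M J by (auto intro!: card_ge_0_finite)

lemma MJ_nonneg [simp]: "0 \<le> M" "0 \<le> J" "0 \<le> M * J" "\<bar>M\<bar> = M"
  using M J by auto

lemma card_pairs: "real (card (Msgs \<times> Idxs)) = M * J"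
  by (simp add: card_cartesian_product card_Msgs card_Idxs)

text \<open>Tail masses of information densities under the joint laws of \<open>(U,Y)\<close>,
  \<open>(U,S)\<close> and \<open>(U,Z)\<close>: too small for the decoder in \<open>eY\<close>, too
  large for covering with \<open>J\<close> codewords in \<open>eS\<close> and with
  \<open>M * J\<close> codewords in \<open>eZ\<close>.\<close>

definition eY where "eY = (\<Sum>u\<in>US. \<Sum>y\<in>YS. p u * VY u y * of_bool (VY u y \<le> \<tau> * PY y))"
definition eS where "eS = (\<Sum>u\<in>US. \<Sum>s\<in>SS. p u * v u s * of_bool (v u s > J * \<theta> * q s))"
definition eZ where "eZ = (\<Sum>u\<in>US. \<Sum>z\<in>ZS. p u * VZ u z * of_bool (VZ u z > M * J * \<theta> * PZ z))"
text \<open>Mass of the triples for which a single pair \<open>(m, s)\<close>, with its index fixed,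
  contributes more than \<open>\<theta> * PZ z\<close> to the warden's law, that is
  \<open>q s * wz u s z / M > \<theta> * PZ z\<close>.\<close>

definition eB where
  "eB = (\<Sum>u\<in>US. \<Sum>s\<in>SS. \<Sum>z\<in>ZS. p u * v u s * wz u s z * of_bool (q s * wz u s z > M * \<theta> * PZ z))"

sublocale cb: finite_product "Msgs \<times> Idxs" "\<lambda>_. US" "\<lambda>_. p"
  by unfold_locales (auto simp: fin fin_idx p0 p1)

text \<open>A wrong index for the right message is no error. When no codeword passes, or several
  messages have one that does, the arbitrary choice is paid for by the union bound in
  \<open>dec_error_le\<close>.\<close>

definition dec :: "('m \<times> 'j \<Rightarrow> 'u) \<Rightarrow> 'y \<Rightarrow> 'm" where
  "dec c y = (SOME m. m \<in> Msgs \<and> (\<exists>j\<in>Idxs. VY (c (m, j)) y > \<tau> * PY y))"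

definition err_ideal :: "('m \<times> 'j \<Rightarrow> 'u) \<Rightarrow> real" where
  "err_ideal c = (\<Sum>i\<in>Msgs \<times> Idxs. \<Sum>y\<in>YS. 1 / (M * J) * (VY (c i) y * of_bool (dec c y \<noteq> fst i)))"

text \<open>An L1 distance, twice the total variation, averaged over messages because the encoder
  sees only the codewords of its own message. The index set \<open>{m} \<times> Idxs\<close> lets
  \<open>E_abs_dev\<close> apply to part of the codebook.\<close>

definition tvS :: "('m \<times> 'j \<Rightarrow> 'u) \<Rightarrow> real" where
  "tvS c = (\<Sum>m\<in>Msgs. \<Sum>s\<in>SS. 1 / M * \<bar>(\<Sum>i\<in>{m} \<times> Idxs. v (c i) s / J) - q s\<bar>)"

definition tvZ :: "('m \<times> 'j \<Rightarrow> 'u) \<Rightarrow> real" where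
  "tvZ c = (\<Sum>z\<in>ZS. \<bar>(\<Sum>i\<in>Msgs \<times> Idxs. VZ (c i) z / (M * J)) - PZ z\<bar>)"

definition atyp :: "'u \<Rightarrow> 's \<Rightarrow> 'z \<Rightarrow> real" where
  "atyp u s z = of_bool (q s * wz u s z > M * \<theta> * PZ z)"

definition bad :: "('m \<times> 'j \<Rightarrow> 'u) \<Rightarrow> real" where
  "bad c = (\<Sum>i\<in>Msgs \<times> Idxs. 1 / (M * J) * (\<Sum>s\<in>SS. \<Sum>z\<in>ZS. v (c i) s * wz (c i) s z * atyp (c i) s z))"

text \<open>If the sent codeword passes, some message qualifies, so the chosen one has a passing
  codeword; being a different message, it belongs to an index pair other than
  \<open>i\<close>.\<close>

lemma dec_error_le:
  assumes "i \<in> Msgs \<times> Idxs"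
  shows "of_bool (dec c y \<noteq> fst i) \<le> of_bool (VY (c i) y \<le> \<tau> * PY y)
     + (\<Sum>k\<in>(Msgs \<times> Idxs) - {i}. of_bool (VY (c k) y > \<tau> * PY y) :: real)"
proof (cases "dec c y \<noteq> fst i \<and> VY (c i) y > \<tau> * PY y")
  case True
  obtain m j where i: "i = (m, j)" "m \<in> Msgs" "j \<in> Idxs" using assms by auto
  have "dec c y \<in> Msgs \<and> (\<exists>j\<in>Idxs. VY (c (dec c y, j)) y > \<tau> * PY y)"
    unfolding dec_def by (rule someI[of _ m]) (use True i in auto)
  then obtain j' where j': "dec c y \<in> Msgs" "j' \<in> Idxs" "VY (c (dec c y, j')) y > \<tau> * PY y" by auto
  have "(of_bool (VY (c (dec c y, j')) y > \<tau> * PY y) :: real)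
      \<le> (\<Sum>k\<in>(Msgs \<times> Idxs) - {i}. of_bool (VY (c k) y > \<tau> * PY y))"
    using j' True i by (intro member_le_sum) (auto simp: fin_idx)
  then show ?thesis using j' by simp
next
  case False
  then show ?thesis by (auto intro!: add_increasing2 sum_nonneg)
qed

lemma mean_eq: "cb.mean i g = (\<Sum>u\<in>US. p u * g u)"
  by (simp add: cb.mean_def)

text \<open>A competing codeword is independent of the sent one, so averaging over the latter
  replaces \<open>VY\<close> by \<open>PY\<close>. Where the competitor passes, \<open>PY y\<close>
  is below \<open>VY u y / \<tau>\<close>; after summation over \<open>y\<close> each of the at most
  \<open>M * J\<close> competitors costs at most \<open>1 / \<tau>\<close>.\<close>

lemma E_err_ideal: "cb.E err_ideal \<le> eY + M * J / \<tau>"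
proof -
  define T where "T u y = (of_bool (VY u y > \<tau> * PY y) :: real)" for u y
  have step: "cb.E (\<lambda>c. VY (c i) y * of_bool (dec c y \<noteq> fst i))
      \<le> (\<Sum>u\<in>US. p u * VY u y * of_bool (VY u y \<le> \<tau> * PY y)) + M * J * ((\<Sum>u\<in>US. p u * VY u y) / \<tau>)"
    if i: "i \<in> Msgs \<times> Idxs" and y: "y \<in> YS" for i y
  proof -
    have "cb.E (\<lambda>c. VY (c i) y * of_bool (dec c y \<noteq> fst i))
      \<le> cb.E (\<lambda>c. VY (c i) y * of_bool (VY (c i) y \<le> \<tau> * PY y)
               + (\<Sum>k\<in>(Msgs \<times> Idxs) - {i}. VY (c i) y * T (c k) y))"
    proof (intro cb.E_mono)
      fix c assume c: "c \<in> PiE (Msgs \<times> Idxs) (\<lambda>_. US)"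
      have "c i \<in> US" using c i by (auto simp: PiE_iff)
      from mult_left_mono[OF dec_error_le[OF i, of c y] VY0[OF this y]]
      show "VY (c i) y * of_bool (dec c y \<noteq> fst i) \<le> VY (c i) y * of_bool (VY (c i) y \<le> \<tau> * PY y)
               + (\<Sum>k\<in>(Msgs \<times> Idxs) - {i}. VY (c i) y * T (c k) y)"
        unfolding T_def distrib_left sum_distrib_left .
    qed
    also have "\<dots> = cb.E (\<lambda>c. VY (c i) y * of_bool (VY (c i) y \<le> \<tau> * PY y))
               + (\<Sum>k\<in>(Msgs \<times> Idxs) - {i}. cb.E (\<lambda>c. VY (c i) y * T (c k) y))"
      by (simp only: cb.E_add cb.E_sum)
    also have "cb.E (\<lambda>c. VY (c i) y * of_bool (VY (c i) y \<le> \<tau> * PY y))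
        = (\<Sum>u\<in>US. p u * VY u y * of_bool (VY u y \<le> \<tau> * PY y))"
      using cb.E_single[OF i, of "\<lambda>u. VY u y * of_bool (VY u y \<le> \<tau> * PY y)"]
      by (simp add: mean_eq mult.assoc)
    also have "(\<Sum>k\<in>(Msgs \<times> Idxs) - {i}. cb.E (\<lambda>c. VY (c i) y * T (c k) y))
        \<le> (\<Sum>k\<in>(Msgs \<times> Idxs) - {i}. (\<Sum>u\<in>US. p u * VY u y) / \<tau>)"
    proof (intro sum_mono)
      fix k assume k: "k \<in> (Msgs \<times> Idxs) - {i}"
      have "cb.E (\<lambda>c. VY (c i) y * T (c k) y) = PY y * (\<Sum>u\<in>US. p u * T u y)"
        using cb.E_pair[OF i, of k "\<lambda>u. VY u y" "\<lambda>u. T u y"] k y by (auto simp: mean_eq PY_eq)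
      also have "\<dots> = (\<Sum>u\<in>US. p u * (PY y * T u y))"
        by (simp add: sum_distrib_left algebra_simps)
      also have "\<dots> \<le> (\<Sum>u\<in>US. p u * (VY u y / \<tau>))"
      proof (intro sum_mono mult_left_mono p0)
        fix u assume u: "u \<in> US"
        show "PY y * T u y \<le> VY u y / \<tau>"
          using VY0[OF u y] \<tau> by (auto simp: T_def field_simps)
      qed
      finally show "cb.E (\<lambda>c. VY (c i) y * T (c k) y) \<le> (\<Sum>u\<in>US. p u * VY u y) / \<tau>"
        by (simp add: sum_divide_distrib)
    qed
    also have "\<dots> \<le> M * J * ((\<Sum>u\<in>US. p u * VY u y) / \<tau>)"
    proof -
      have "card ((Msgs \<times> Idxs) - {i}) \<le> card (Msgs \<times> Idxs)"
        by (intro card_mono) (auto simp: fin_idx)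
      then have "real (card ((Msgs \<times> Idxs) - {i})) \<le> M * J"
        using card_pairs by linarith
      moreover have "0 \<le> (\<Sum>u\<in>US. p u * VY u y) / \<tau>"
        using \<tau> y by (intro divide_nonneg_pos sum_nonneg mult_nonneg_nonneg p0 VY0) auto
      ultimately show ?thesis by (simp only: sum_constant) (rule mult_right_mono)
    qed
    finally show ?thesis by simp
  qed
  have yy: "(\<Sum>y\<in>YS. (\<Sum>u\<in>US. p u * VY u y)) = 1"
    by (subst sum.swap) (simp add: VY1 p1 flip: sum_distrib_left)
  have "cb.E err_ideal
      = (\<Sum>i\<in>Msgs \<times> Idxs. \<Sum>y\<in>YS. 1 / (M * J) * cb.E (\<lambda>c. VY (c i) y * of_bool (dec c y \<noteq> fst i)))"
    unfolding err_ideal_def by (simp only: cb.E_sum cb.E_cmult)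
  also have "\<dots> \<le> (\<Sum>i\<in>Msgs \<times> Idxs. \<Sum>y\<in>YS. 1 / (M * J) *
     ((\<Sum>u\<in>US. p u * VY u y * of_bool (VY u y \<le> \<tau> * PY y)) + M * J * ((\<Sum>u\<in>US. p u * VY u y) / \<tau>)))"
    by (intro sum_mono mult_left_mono step) auto
  also have "\<dots> = (\<Sum>y\<in>YS.
     ((\<Sum>u\<in>US. p u * VY u y * of_bool (VY u y \<le> \<tau> * PY y)) + M * J * ((\<Sum>u\<in>US. p u * VY u y) / \<tau>)))"
    using M J by (simp add: card_pairs flip: sum_distrib_left sum_divide_distrib)
  also have "\<dots> = eY + M * J * ((\<Sum>y\<in>YS. (\<Sum>u\<in>US. p u * VY u y)) / \<tau>)"
    unfolding sum.distrib eY_def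
    by (subst sum.swap) (simp add: sum_divide_distrib flip: sum_distrib_left)
  finally show ?thesis by (simp add: yy)
qed

text \<open>Soft covering by the \<open>J\<close> codewords of one message: the terms
  \<open>v u s / J\<close> have total mean \<open>q s\<close>, which is also taken as the level, and
  exceeding \<open>\<theta> * q s\<close> is exactly the event of \<open>eS\<close>.\<close>

lemma E_tvS: "cb.E tvS \<le> 2 * eS + sqrt \<theta>"
proof -
  have step: "cb.E (\<lambda>c. \<bar>(\<Sum>i\<in>{m} \<times> Idxs. v (c i) s / J) - q s\<bar>)
      \<le> 2 * (\<Sum>u\<in>US. p u * v u s * of_bool (v u s > J * \<theta> * q s)) + sqrt \<theta> * q s"
    if m: "m \<in> Msgs" and s: "s \<in> SS" for m s
  proof -
    have mean: "cb.mean i (\<lambda>u. v u s / J) = q s / J" for i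
      by (simp add: mean_eq q_eq s sum_divide_distrib)
    have "(\<Sum>i\<in>{m} \<times> Idxs. cb.mean i (\<lambda>u. v u s / J)) = q s"
      using J by (simp add: mean card_cartesian_product card_Idxs)
    moreover have "(\<Sum>i\<in>{m} \<times> Idxs. cb.mean i (\<lambda>u. v u s / J * of_bool (v u s / J > \<theta> * q s)))
      = (\<Sum>u\<in>US. p u * v u s * of_bool (v u s > J * \<theta> * q s))"
    proof -
      have "cb.mean i (\<lambda>u. v u s / J * of_bool (v u s / J > \<theta> * q s))
          = (\<Sum>u\<in>US. p u * v u s * of_bool (v u s > J * \<theta> * q s)) / J" for i
        using J by (simp add: mean_eq sum_divide_distrib field_simps)
      then show ?thesis using J by (simp add: card_cartesian_product card_Idxs)
    qed
    ultimately show ?thesis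
      using cb.E_abs_dev[of "{m} \<times> Idxs" "\<lambda>_ u. v u s / J" "q s" \<theta>] m s J
      by (auto simp: v0 q0 \<theta>)
  qed
  have "cb.E tvS = (\<Sum>m\<in>Msgs. \<Sum>s\<in>SS. 1 / M * cb.E (\<lambda>c. \<bar>(\<Sum>i\<in>{m} \<times> Idxs. v (c i) s / J) - q s\<bar>))"
    unfolding tvS_def by (simp only: cb.E_sum cb.E_cmult)
  also have "\<dots> \<le> (\<Sum>m\<in>Msgs. \<Sum>s\<in>SS. 1 / M * (2 * (\<Sum>u\<in>US. p u * v u s * of_bool (v u s > J * \<theta> * q s))
      + sqrt \<theta> * q s))"
    by (intro sum_mono mult_left_mono step) auto
  also have "\<dots> = (\<Sum>s\<in>SS. 2 * (\<Sum>u\<in>US. p u * v u s * of_bool (v u s > J * \<theta> * q s)) + sqrt \<theta> * q s)"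
    using M by (simp add: card_Msgs flip: sum_distrib_left sum_divide_distrib)
  also have "\<dots> = 2 * eS + sqrt \<theta> * (\<Sum>s\<in>SS. q s)"
    unfolding sum.distrib eS_def sum_distrib_left[symmetric] by (simp only: sum.swap[of _ US])
  finally show ?thesis by (simp add: q1)
qed

text \<open>The same covering argument with the whole codebook of \<open>M * J\<close> words, the
  warden having no access to the message.\<close>

lemma E_tvZ: "cb.E tvZ \<le> 2 * eZ + sqrt \<theta>"
proof -
  have MJ: "M * J > 0" using M J by simp
  have step: "cb.E (\<lambda>c. \<bar>(\<Sum>i\<in>Msgs \<times> Idxs. VZ (c i) z / (M * J)) - PZ z\<bar>)
      \<le> 2 * (\<Sum>u\<in>US. p u * VZ u z * of_bool (VZ u z > M * J * \<theta> * PZ z)) + sqrt \<theta> * PZ z"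
    if z: "z \<in> ZS" for z
  proof -
    have mean: "cb.mean i (\<lambda>u. VZ u z / (M * J)) = PZ z / (M * J)" for i
      by (simp add: mean_eq PZ_eq z sum_divide_distrib)
    have "(\<Sum>i\<in>Msgs \<times> Idxs. cb.mean i (\<lambda>u. VZ u z / (M * J))) = PZ z"
      using M J by (simp add: mean card_pairs)
    moreover have "(\<Sum>i\<in>Msgs \<times> Idxs. cb.mean i (\<lambda>u. VZ u z / (M * J) * of_bool (VZ u z / (M * J) > \<theta> * PZ z)))
      = (\<Sum>u\<in>US. p u * VZ u z * of_bool (VZ u z > M * J * \<theta> * PZ z))"
    proof -
      have "cb.mean i (\<lambda>u. VZ u z / (M * J) * of_bool (VZ u z / (M * J) > \<theta> * PZ z))
          = (\<Sum>u\<in>US. p u * VZ u z * of_bool (VZ u z > M * J * \<theta> * PZ z)) / (M * J)" for i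
        using MJ by (simp add: mean_eq sum_divide_distrib field_simps)
      then show ?thesis using M J by (simp add: card_pairs)
    qed
    ultimately show ?thesis
      using cb.E_abs_dev[of "Msgs \<times> Idxs" "\<lambda>_ u. VZ u z / (M * J)" "PZ z" \<theta>] z PZ_pos[OF z]
      using MJ by (simp add: VZ0 \<theta>)
  qed
  have "cb.E tvZ \<le> (\<Sum>z\<in>ZS. 2 * (\<Sum>u\<in>US. p u * VZ u z * of_bool (VZ u z > M * J * \<theta> * PZ z)) + sqrt \<theta> * PZ z)"
    unfolding tvZ_def cb.E_sum by (intro sum_mono step)
  also have "\<dots> = 2 * eZ + sqrt \<theta> * (\<Sum>z\<in>ZS. PZ z)"
    unfolding sum.distrib eZ_def sum_distrib_left[symmetric] by (simp only: sum.swap[of _ US])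
  finally show ?thesis by (simp add: PZ1)
qed

lemma E_bad: "cb.E bad = eB"
proof -
  define h where "h u = (\<Sum>s\<in>SS. \<Sum>z\<in>ZS. v u s * wz u s z * atyp u s z)" for u
  have "cb.E bad = (\<Sum>i\<in>Msgs \<times> Idxs. 1 / (M * J) * cb.E (\<lambda>c. h (c i)))"
    unfolding bad_def cb.E_sum[of _ "Msgs \<times> Idxs"] cb.E_cmult h_def ..
  also have "\<dots> = (\<Sum>i\<in>Msgs \<times> Idxs. 1 / (M * J) * (\<Sum>u\<in>US. p u * h u))"
    by (intro sum.cong refl arg_cong2[of _ _ _ _ "(*)"]) (simp add: cb.E_single mean_eq)
  also have "\<dots> = (\<Sum>u\<in>US. p u * h u)"
    using M J by (simp add: card_pairs)
  finally show ?thesis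
    by (simp add: h_def eB_def atyp_def sum_distrib_left mult.assoc)
qed

text \<open>
  The likelihood encoder, with a uniform choice where the posterior is undefined.
\<close>

definition L :: "('m \<times> 'j \<Rightarrow> 'u) \<Rightarrow> 'm \<Rightarrow> 's \<Rightarrow> 'j \<Rightarrow> real" where
  "L c m s j = (if (\<Sum>k\<in>Idxs. v (c (m, k)) s) = 0 then 1 / J
     else v (c (m, j)) s / (\<Sum>k\<in>Idxs. v (c (m, k)) s))"

section \<open>The true experiment for a fixed codebook, and its derandomisation\<close>

context
  fixes c assumes c: "c \<in> PiE (Msgs \<times> Idxs) (\<lambda>_. US)"
begin

lemma c_in: "m \<in> Msgs \<Longrightarrow> j \<in> Idxs \<Longrightarrow> c (m, j) \<in> US"
  using c by (auto simp: PiE_iff)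

lemma wz_total:
  "m \<in> Msgs \<Longrightarrow> s \<in> SS \<Longrightarrow> j \<in> Idxs \<Longrightarrow> (\<Sum>z\<in>ZS. a * (b * wz (c (m, j)) s z)) = a * b"
  by (simp add: wz1 c_in flip: sum_distrib_left)

lemma L0: "m \<in> Msgs \<Longrightarrow> s \<in> SS \<Longrightarrow> j \<in> Idxs \<Longrightarrow> 0 \<le> L c m s j"
  unfolding L_def by (auto intro!: divide_nonneg_nonneg sum_nonneg v0 c_in)

lemma L1: "(\<Sum>j\<in>Idxs. L c m s j) = 1"
  using J by (cases "(\<Sum>k\<in>Idxs. v (c (m, k)) s) = 0")
    (simp_all add: L_def card_Idxs flip: sum_divide_distrib)

text \<open>Bayes' rule in the ideal experiment. It survives the uniform default, since nonnegative
  likelihoods with sum zero all vanish.\<close>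

lemma L_posterior:
  assumes "m \<in> Msgs" "s \<in> SS" "j \<in> Idxs"
  shows "v (c (m, j)) s / J = (\<Sum>k\<in>Idxs. v (c (m, k)) s / J) * L c m s j"
proof (cases "(\<Sum>k\<in>Idxs. v (c (m, k)) s) = 0")
  case True
  then have "v (c (m, j)) s = 0"
    using assms sum_nonneg_eq_0_iff[of Idxs "\<lambda>k. v (c (m, k)) s"] v0 c_in fin_idx by auto
  then show ?thesis using True by (simp flip: sum_divide_distrib)
next
  case False
  then show ?thesis by (simp add: L_def flip: sum_divide_distrib)
qed

text \<open>True and ideal laws of \<open>(m, s, j)\<close> share the conditional law
  \<open>L\<close> of \<open>j\<close>, so their distance is already that of the laws of
  \<open>(m, s)\<close>.\<close>

lemma posterior_dist:
  "(\<Sum>m\<in>Msgs. \<Sum>s\<in>SS. \<Sum>j\<in>Idxs. 1 / M * \<bar>q s * L c m s j - v (c (m, j)) s / J\<bar>) = tvS c"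
  unfolding tvS_def
proof (intro sum.cong refl)
  fix m s assume ms: "m \<in> Msgs" "s \<in> SS"
  define D where "D = (\<Sum>k\<in>Idxs. v (c (m, k)) s / J)"
  have "\<bar>q s * L c m s j - v (c (m, j)) s / J\<bar> = L c m s j * \<bar>D - q s\<bar>" if "j \<in> Idxs" for j
  proof -
    have "q s * L c m s j - v (c (m, j)) s / J = L c m s j * (q s - D)"
      using L_posterior[OF ms that] by (simp add: D_def algebra_simps)
    then show ?thesis using L0[OF ms that] by (simp add: abs_mult abs_minus_commute)
  qed
  then have "(\<Sum>j\<in>Idxs. \<bar>q s * L c m s j - v (c (m, j)) s / J\<bar>) = (\<Sum>j\<in>Idxs. L c m s j) * \<bar>D - q s\<bar>"
    by (simp add: sum_distrib_right)
  moreover have "D = (\<Sum>i\<in>{m} \<times> Idxs. v (c i) s / J)"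
    by (simp add: D_def sum.cartesian_product')
  ultimately show "(\<Sum>j\<in>Idxs. 1 / M * \<bar>q s * L c m s j - v (c (m, j)) s / J\<bar>)
      = 1 / M * \<bar>(\<Sum>i\<in>{m} \<times> Idxs. v (c i) s / J) - q s\<bar>"
    by (simp only: sum_distrib_left[symmetric] L1 mult_1_left)
qed

text \<open>Change of measure: passing from the true to the ideal law costs at most their L1
  distance for a test function with values in the unit interval. It is applied to the conditional
  probabilities of decoding error and of \<open>atyp\<close>.\<close>

lemma likelihood_transfer:
  assumes "\<And>m j s. m \<in> Msgs \<Longrightarrow> j \<in> Idxs \<Longrightarrow> s \<in> SS \<Longrightarrow> 0 \<le> g m j s \<and> g m j s \<le> 1"
  shows "(\<Sum>m\<in>Msgs. \<Sum>s\<in>SS. \<Sum>j\<in>Idxs. 1 / M * (q s * L c m s j * g m j s))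
     \<le> (\<Sum>m\<in>Msgs. \<Sum>j\<in>Idxs. \<Sum>s\<in>SS. 1 / (M * J) * (v (c (m, j)) s * g m j s)) + tvS c"
proof -
  have "(\<Sum>m\<in>Msgs. \<Sum>s\<in>SS. \<Sum>j\<in>Idxs. 1 / M * (q s * L c m s j * g m j s))
     \<le> (\<Sum>m\<in>Msgs. \<Sum>s\<in>SS. \<Sum>j\<in>Idxs. 1 / (M * J) * (v (c (m, j)) s * g m j s)
          + 1 / M * \<bar>q s * L c m s j - v (c (m, j)) s / J\<bar>)"
  proof (intro sum_mono)
    fix m s j assume mjs: "m \<in> Msgs" "s \<in> SS" "j \<in> Idxs"
    note g = assms[OF mjs(1) mjs(3) mjs(2)]
    have "(q s * L c m s j - v (c (m, j)) s / J) * g m j s \<le> \<bar>q s * L c m s j - v (c (m, j)) s / J\<bar> * 1"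
      using g by (intro mult_mono) auto
    then have "q s * L c m s j * g m j s \<le> v (c (m, j)) s / J * g m j s + \<bar>q s * L c m s j - v (c (m, j)) s / J\<bar>"
      by (simp add: algebra_simps)
    then have "1 / M * (q s * L c m s j * g m j s)
       \<le> 1 / M * (v (c (m, j)) s / J * g m j s + \<bar>q s * L c m s j - v (c (m, j)) s / J\<bar>)"
      by (intro mult_left_mono) auto
    then show "1 / M * (q s * L c m s j * g m j s) \<le> 1 / (M * J) * (v (c (m, j)) s * g m j s)
          + 1 / M * \<bar>q s * L c m s j - v (c (m, j)) s / J\<bar>"
      by (simp add: distrib_left)
  qed
  also have "\<dots> = (\<Sum>m\<in>Msgs. \<Sum>s\<in>SS. \<Sum>j\<in>Idxs. 1 / (M * J) * (v (c (m, j)) s * g m j s)) + tvS c"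
    by (simp only: sum.distrib posterior_dist)
  also have "(\<Sum>m\<in>Msgs. \<Sum>s\<in>SS. \<Sum>j\<in>Idxs. 1 / (M * J) * (v (c (m, j)) s * g m j s))
    = (\<Sum>m\<in>Msgs. \<Sum>j\<in>Idxs. \<Sum>s\<in>SS. 1 / (M * J) * (v (c (m, j)) s * g m j s))"
    by (intro sum.cong refl sum.swap)
  finally show ?thesis .
qed

text \<open>The warden's law when the likelihood encoder really randomises, hence the mean of the
  warden's law over random selections.\<close>

definition PZst :: "'z \<Rightarrow> real" where
  "PZst z = (\<Sum>m\<in>Msgs. \<Sum>s\<in>SS. \<Sum>j\<in>Idxs. 1 / M * (q s * L c m s j * wz (c (m, j)) s z))"

text \<open>Triangle inequality through the warden's law \<open>W\<close> of the ideal experiment: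
  applying the kernel \<open>wz\<close> cannot increase the distance \<open>tvS c\<close>, and
  \<open>W\<close> is at distance \<open>tvZ c\<close> from \<open>PZ\<close>.\<close>

lemma PZst_dist: "(\<Sum>z\<in>ZS. \<bar>PZst z - PZ z\<bar>) \<le> tvS c + tvZ c"
proof -
  define D where "D m s j = q s * L c m s j - v (c (m, j)) s / J" for m s j
  define W where "W z = (\<Sum>i\<in>Msgs \<times> Idxs. VZ (c i) z / (M * J))" for z
  have "(\<Sum>z\<in>ZS. \<bar>PZst z - W z\<bar>)
      \<le> (\<Sum>z\<in>ZS. \<Sum>m\<in>Msgs. \<Sum>s\<in>SS. \<Sum>j\<in>Idxs. 1 / M * (\<bar>D m s j\<bar> * wz (c (m, j)) s z))"
  proof (intro sum_mono)
    fix z assume z: "z \<in> ZS"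
    have "W z = (\<Sum>m\<in>Msgs. \<Sum>j\<in>Idxs. VZ (c (m, j)) z / (M * J))"
      by (simp add: W_def sum.cartesian_product)
    also have "\<dots> = (\<Sum>m\<in>Msgs. \<Sum>j\<in>Idxs. \<Sum>s\<in>SS. 1 / M * (v (c (m, j)) s / J * wz (c (m, j)) s z))"
      by (intro sum.cong refl) (simp only: VZ_eq[OF c_in z], simp add: sum_divide_distrib mult.commute)
    also have "\<dots> = (\<Sum>m\<in>Msgs. \<Sum>s\<in>SS. \<Sum>j\<in>Idxs. 1 / M * (v (c (m, j)) s / J * wz (c (m, j)) s z))"
      by (intro sum.cong refl sum.swap)
    finally have "PZst z - W z = (\<Sum>m\<in>Msgs. \<Sum>s\<in>SS. \<Sum>j\<in>Idxs. 1 / M * (D m s j * wz (c (m, j)) s z))"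
      unfolding PZst_def D_def by (simp add: left_diff_distrib right_diff_distrib diff_divide_distrib sum_subtractf)
    then show "\<bar>PZst z - W z\<bar> \<le> (\<Sum>m\<in>Msgs. \<Sum>s\<in>SS. \<Sum>j\<in>Idxs. 1 / M * (\<bar>D m s j\<bar> * wz (c (m, j)) s z))"
      using z by (auto intro!: order.trans[OF sum_abs] sum_mono simp: abs_mult abs_of_nonneg wz0 c_in)
  qed
  also have "\<dots> = (\<Sum>m\<in>Msgs. \<Sum>s\<in>SS. \<Sum>j\<in>Idxs. \<Sum>z\<in>ZS. 1 / M * (\<bar>D m s j\<bar> * wz (c (m, j)) s z))"
    by (subst sum.swap, intro sum.cong refl, subst sum.swap, intro sum.cong refl, rule sum.swap)
  also have "\<dots> = (\<Sum>m\<in>Msgs. \<Sum>s\<in>SS. \<Sum>j\<in>Idxs. 1 / M * \<bar>D m s j\<bar>)"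
    by (intro sum.cong refl wz_total)
  also have "\<dots> = tvS c" unfolding D_def by (rule posterior_dist)
  finally have "(\<Sum>z\<in>ZS. \<bar>PZst z - W z\<bar>) \<le> tvS c" .
  moreover have "(\<Sum>z\<in>ZS. \<bar>PZst z - PZ z\<bar>) \<le> (\<Sum>z\<in>ZS. \<bar>PZst z - W z\<bar> + \<bar>W z - PZ z\<bar>)"
    by (intro sum_mono) auto
  ultimately show ?thesis by (simp add: tvZ_def W_def sum.distrib)
qed

lemma PZst1: "(\<Sum>z\<in>ZS. PZst z) = 1"
proof -
  have "(\<Sum>z\<in>ZS. PZst z)
    = (\<Sum>m\<in>Msgs. \<Sum>s\<in>SS. \<Sum>j\<in>Idxs. \<Sum>z\<in>ZS. 1 / M * (q s * L c m s j * wz (c (m, j)) s z))"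
    unfolding PZst_def
    by (subst sum.swap, intro sum.cong refl, subst sum.swap, intro sum.cong refl, rule sum.swap)
  also have "\<dots> = (\<Sum>m\<in>Msgs. \<Sum>s\<in>SS. \<Sum>j\<in>Idxs. 1 / M * (q s * L c m s j))"
    by (intro sum.cong refl wz_total)
  also have "\<dots> = 1"
    using M by (simp add: L1 q1 card_Msgs flip: sum_distrib_left sum_divide_distrib)
  finally show ?thesis .
qed

text \<open>Drawing one index per pair \<open>(m, s)\<close> from \<open>L c m s\<close>,
  independently, keeps the mean error and has mean warden law \<open>PZst\<close>. Only the
  fluctuation around \<open>PZst\<close> is new; \<open>E_abs_dev\<close> controls it by
  \<open>bad\<close> and \<open>sqrt \<theta>\<close>. Error and distance stay in one sum, so a
  single table \<open>t\<close> is good for both.\<close>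

lemma deterministic_selection:
  "\<exists>t. (\<forall>m\<in>Msgs. \<forall>s\<in>SS. t m s \<in> Idxs) \<and>
     (\<Sum>m\<in>Msgs. \<Sum>s\<in>SS. \<Sum>y\<in>YS. 1 / M * (q s * wy (c (m, t m s)) s y * of_bool (dec c y \<noteq> m)))
     + (\<Sum>z\<in>ZS. \<bar>(\<Sum>m\<in>Msgs. \<Sum>s\<in>SS. 1 / M * (q s * wz (c (m, t m s)) s z)) - PZ z\<bar>)
     \<le> err_ideal c + 4 * tvS c + tvZ c + 2 * bad c + sqrt \<theta>"
proof -
  interpret sel: finite_product "Msgs \<times> SS" "\<lambda>_. Idxs" "\<lambda>(m, s). L c m s"
    by unfold_locales (auto simp: fin fin_idx L1 L0)
  have mean: "sel.mean (m, s) g = (\<Sum>j\<in>Idxs. L c m s j * g j)" for m s g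
    by (simp add: sel.mean_def)
  define f where "f z = (\<lambda>(m, s) j. 1 / M * (q s * wz (c (m, j)) s z))" for z
  define ge where "ge = (\<lambda>(m, s) j. \<Sum>y\<in>YS. 1 / M * (q s * wy (c (m, j)) s y * of_bool (dec c y \<noteq> m)))"
  define F where "F t = (\<Sum>i\<in>Msgs \<times> SS. ge i (t i))
     + (\<Sum>z\<in>ZS. \<bar>(\<Sum>i\<in>Msgs \<times> SS. f z i (t i)) - PZ z\<bar>)" for t
  have mean_f: "(\<Sum>i\<in>Msgs \<times> SS. sel.mean i (f z i)) = PZst z" for z
    by (simp add: PZst_def f_def mean sum.cartesian_product' algebra_simps)
  have err: "sel.E (\<lambda>t. \<Sum>i\<in>Msgs \<times> SS. ge i (t i)) \<le> err_ideal c + tvS c"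
  proof -
    define g where "g m j s = (\<Sum>y\<in>YS. wy (c (m, j)) s y * of_bool (dec c y \<noteq> m))" for m j s
    have g01: "0 \<le> g m j s \<and> g m j s \<le> 1" if "m \<in> Msgs" "j \<in> Idxs" "s \<in> SS" for m j s
    proof
      show "0 \<le> g m j s" unfolding g_def using that by (intro sum_nonneg mult_nonneg_nonneg wy0 c_in) auto
      have "g m j s \<le> (\<Sum>y\<in>YS. wy (c (m, j)) s y)" unfolding g_def
        using that by (intro sum_mono) (auto simp: wy0 c_in)
      then show "g m j s \<le> 1" using that by (simp add: wy1 c_in)
    qed
    have "sel.E (\<lambda>t. \<Sum>i\<in>Msgs \<times> SS. ge i (t i)) = (\<Sum>i\<in>Msgs \<times> SS. sel.mean i (ge i))"
      unfolding sel.E_sum by (intro sum.cong refl sel.E_single)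
    also have "\<dots> = (\<Sum>m\<in>Msgs. \<Sum>s\<in>SS. \<Sum>j\<in>Idxs. 1 / M * (q s * L c m s j * g m j s))"
      by (simp add: ge_def g_def mean sum.cartesian_product' sum_distrib_left algebra_simps)
    also have "\<dots> \<le> (\<Sum>m\<in>Msgs. \<Sum>j\<in>Idxs. \<Sum>s\<in>SS. 1 / (M * J) * (v (c (m, j)) s * g m j s)) + tvS c"
      by (rule likelihood_transfer) (rule g01)
    also have "(\<Sum>m\<in>Msgs. \<Sum>j\<in>Idxs. \<Sum>s\<in>SS. 1 / (M * J) * (v (c (m, j)) s * g m j s)) = err_ideal c"
    proof -
      have "err_ideal c = (\<Sum>m\<in>Msgs. \<Sum>j\<in>Idxs. \<Sum>y\<in>YS. 1 / (M * J) * (VY (c (m, j)) y * of_bool (dec c y \<noteq> m)))"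
        by (simp add: err_ideal_def sum.cartesian_product')
      also have "\<dots> = (\<Sum>m\<in>Msgs. \<Sum>j\<in>Idxs. \<Sum>y\<in>YS. \<Sum>s\<in>SS. 1 / (M * J) * (v (c (m, j)) s * (wy (c (m, j)) s y * of_bool (dec c y \<noteq> m))))"
        by (intro sum.cong refl) (simp only: VY_eq[OF c_in], simp add: sum_divide_distrib sum_distrib_right mult.assoc)
      also have "\<dots> = (\<Sum>m\<in>Msgs. \<Sum>j\<in>Idxs. \<Sum>s\<in>SS. \<Sum>y\<in>YS. 1 / (M * J) * (v (c (m, j)) s * (wy (c (m, j)) s y * of_bool (dec c y \<noteq> m))))"
        by (intro sum.cong refl sum.swap)
      finally show ?thesis by (simp add: g_def sum_distrib_left)
    qed
    finally show ?thesis .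
  qed
  have dev: "(\<Sum>z\<in>ZS. sel.E (\<lambda>t. \<bar>(\<Sum>i\<in>Msgs \<times> SS. f z i (t i)) - PZst z\<bar>)) \<le> 2 * (bad c + tvS c) + sqrt \<theta>"
  proof -
    define g where "g m j s = (\<Sum>z\<in>ZS. wz (c (m, j)) s z * atyp (c (m, j)) s z)" for m j s
    have g01: "0 \<le> g m j s \<and> g m j s \<le> 1" if "m \<in> Msgs" "j \<in> Idxs" "s \<in> SS" for m j s
    proof
      show "0 \<le> g m j s" unfolding g_def atyp_def using that by (intro sum_nonneg mult_nonneg_nonneg wz0 c_in) auto
      have "g m j s \<le> (\<Sum>z\<in>ZS. wz (c (m, j)) s z)" unfolding g_def
        using that by (intro sum_mono) (auto simp: wz0 c_in atyp_def)
      then show "g m j s \<le> 1" using that by (simp add: wz1 c_in)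
    qed
    \<comment> \<open>The level is \<open>PZ z\<close>, not the mean \<open>PZst z\<close>: the
      truncation event then becomes \<open>atyp\<close>, which involves the codebook only through
      the codeword in use. Both laws have total mass one, so the last term still sums to
      \<open>sqrt \<theta>\<close>.\<close>
    have one: "sel.E (\<lambda>t. \<bar>(\<Sum>i\<in>Msgs \<times> SS. f z i (t i)) - PZst z\<bar>)
       \<le> 2 * (\<Sum>i\<in>Msgs \<times> SS. sel.mean i (\<lambda>a. f z i a * of_bool (f z i a > \<theta> * PZ z)))
         + sqrt \<theta> * (PZ z + PZst z) / 2" if z: "z \<in> ZS" for z
    proof -
      have "0 \<le> f z i j" if "i \<in> Msgs \<times> SS" "j \<in> Idxs" for i j
        using that z by (auto simp: f_def q0 wz0 c_in)
      then show ?thesis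
        using sel.E_abs_dev[of "Msgs \<times> SS" "f z" "PZ z" \<theta>] PZ_pos[OF z] \<theta>
        unfolding mean_f by auto
    qed
    define H where "H z = (\<Sum>m\<in>Msgs. \<Sum>s\<in>SS. \<Sum>j\<in>Idxs. 1 / M * (q s * L c m s j * (wz (c (m, j)) s z * atyp (c (m, j)) s z)))" for z
    have two: "(\<Sum>i\<in>Msgs \<times> SS. sel.mean i (\<lambda>a. f z i a * of_bool (f z i a > \<theta> * PZ z)))
       = H z" for z
    proof -
      have "f z (m, s) j > \<theta> * PZ z \<longleftrightarrow> q s * wz (c (m, j)) s z > M * \<theta> * PZ z" for m s j
        using M by (simp add: f_def field_simps)
      then show ?thesis
        by (simp add: H_def mean sum.cartesian_product' atyp_def) (simp add: f_def algebra_simps)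
    qed
    have three: "(\<Sum>z\<in>ZS. H z)
       = (\<Sum>m\<in>Msgs. \<Sum>s\<in>SS. \<Sum>j\<in>Idxs. 1 / M * (q s * L c m s j * g m j s))"
      unfolding g_def H_def sum_distrib_left
      by (subst sum.swap, intro sum.cong refl, subst sum.swap, intro sum.cong refl, rule sum.swap)
    have four: "(\<Sum>m\<in>Msgs. \<Sum>j\<in>Idxs. \<Sum>s\<in>SS. 1 / (M * J) * (v (c (m, j)) s * g m j s)) = bad c"
      by (simp add: bad_def g_def sum.cartesian_product' sum_distrib_left sum_divide_distrib mult.assoc)
    have "(\<Sum>z\<in>ZS. sel.E (\<lambda>t. \<bar>(\<Sum>i\<in>Msgs \<times> SS. f z i (t i)) - PZst z\<bar>))
       \<le> (\<Sum>z\<in>ZS. 2 * H z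
         + sqrt \<theta> * (PZ z + PZst z) / 2)"
      using one unfolding two by (intro sum_mono)
    also have "\<dots> = 2 * (\<Sum>m\<in>Msgs. \<Sum>s\<in>SS. \<Sum>j\<in>Idxs. 1 / M * (q s * L c m s j * g m j s))
         + sqrt \<theta> * ((\<Sum>z\<in>ZS. PZ z) + (\<Sum>z\<in>ZS. PZst z)) / 2"
      unfolding sum.distrib sum_distrib_left[symmetric] three sum_divide_distrib[symmetric] by simp
    also have "\<dots> \<le> 2 * (bad c + tvS c) + sqrt \<theta>"
      using likelihood_transfer[of g, OF g01] unfolding four by (simp add: PZ1 PZst1)
    finally show ?thesis .
  qed
  have "sel.E F \<le> sel.E (\<lambda>t. (\<Sum>i\<in>Msgs \<times> SS. ge i (t i)) +
     ((\<Sum>z\<in>ZS. \<bar>(\<Sum>i\<in>Msgs \<times> SS. f z i (t i)) - PZst z\<bar>) + (\<Sum>z\<in>ZS. \<bar>PZst z - PZ z\<bar>)))"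
    unfolding F_def sum.distrib[symmetric] by (intro sel.E_mono add_left_mono sum_mono) auto
  \<comment> \<open>The four copies of \<open>tvS c\<close>: one for transferring the error, two for
    transferring the doubled atypicality term, one for the distance of \<open>PZst\<close> from the
    ideal law.\<close>
  also have "\<dots> \<le> (err_ideal c + tvS c) + ((2 * (bad c + tvS c) + sqrt \<theta>) + (tvS c + tvZ c))"
    unfolding sel.E_add sel.E_sum[of _ ZS] sel.E_const by (intro add_mono err dev PZst_dist)
  finally have le: "sel.E F \<le> err_ideal c + 4 * tvS c + tvZ c + 2 * bad c + sqrt \<theta>" by simp
  obtain t where t: "t \<in> PiE (Msgs \<times> SS) (\<lambda>_. Idxs)" "F t \<le> sel.E F"
    using sel.E_exists by blast
  show ?thesis
  proof (intro exI[of _ "\<lambda>m s. t (m, s)"] conjI ballI)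
    show "t (m, s) \<in> Idxs" if "m \<in> Msgs" "s \<in> SS" for m s
      using t(1) that by (auto simp: PiE_iff)
    show "(\<Sum>m\<in>Msgs. \<Sum>s\<in>SS. \<Sum>y\<in>YS. 1 / M * (q s * wy (c (m, t (m, s))) s y * of_bool (dec c y \<noteq> m)))
     + (\<Sum>z\<in>ZS. \<bar>(\<Sum>m\<in>Msgs. \<Sum>s\<in>SS. 1 / M * (q s * wz (c (m, t (m, s))) s z)) - PZ z\<bar>)
     \<le> err_ideal c + 4 * tvS c + tvZ c + 2 * bad c + sqrt \<theta>"
      using le t(2) by (simp add: F_def ge_def f_def sum.cartesian_product')
  qed
qed

end

text \<open>Average of the bound in \<open>deterministic_selection\<close> over codebooks: the four
  copies of \<open>tvS\<close> give \<open>8 * eS\<close> and \<open>4 * sqrt \<theta>\<close>,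
  \<open>tvZ\<close> and the selection one further \<open>sqrt \<theta>\<close> each.\<close>

theorem one_shot_code:
  "\<exists>e d. (\<forall>m\<in>Msgs. \<forall>s\<in>SS. e m s \<in> US) \<and>
     (\<Sum>m\<in>Msgs. \<Sum>s\<in>SS. \<Sum>y\<in>YS. 1 / M * (q s * wy (e m s) s y * of_bool (d y \<noteq> m)))
     + (\<Sum>z\<in>ZS. \<bar>(\<Sum>m\<in>Msgs. \<Sum>s\<in>SS. 1 / M * (q s * wz (e m s) s z)) - PZ z\<bar>)
     \<le> eY + M * J / \<tau> + 8 * eS + 2 * eZ + 2 * eB + 6 * sqrt \<theta>"
proof -
  define G where "G c = err_ideal c + 4 * tvS c + tvZ c + 2 * bad c + sqrt \<theta>" for c
  have "cb.E G = cb.E err_ideal + 4 * cb.E tvS + cb.E tvZ + 2 * cb.E bad + sqrt \<theta>"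
    unfolding G_def by (simp only: cb.E_add cb.E_cmult cb.E_const)
  also have "\<dots> \<le> (eY + M * J / \<tau>) + 4 * (2 * eS + sqrt \<theta>) + (2 * eZ + sqrt \<theta>) + 2 * eB + sqrt \<theta>"
    unfolding E_bad by (intro add_mono order.refl mult_left_mono E_err_ideal E_tvS E_tvZ) auto
  finally have le: "cb.E G \<le> eY + M * J / \<tau> + 8 * eS + 2 * eZ + 2 * eB + 6 * sqrt \<theta>" by simp
  obtain c where c: "c \<in> PiE (Msgs \<times> Idxs) (\<lambda>_. US)" "G c \<le> cb.E G" using cb.E_exists by blast
  from deterministic_selection[OF c(1)] obtain t where t: "\<forall>m\<in>Msgs. \<forall>s\<in>SS. t m s \<in> Idxs"
    and t2: "(\<Sum>m\<in>Msgs. \<Sum>s\<in>SS. \<Sum>y\<in>YS. 1 / M * (q s * wy (c (m, t m s)) s y * of_bool (dec c y \<noteq> m)))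
     + (\<Sum>z\<in>ZS. \<bar>(\<Sum>m\<in>Msgs. \<Sum>s\<in>SS. 1 / M * (q s * wz (c (m, t m s)) s z)) - PZ z\<bar>) \<le> G c"
    unfolding G_def by blast
  show ?thesis
    using t c_in[OF c(1)] order.trans[OF t2 order.trans[OF c(2) le]]
    by (intro exI[of _ "\<lambda>m s. c (m, t m s)"] exI[of _ "dec c"]) blast
qed

end

section \<open>Exponential tails for words\<close>

definition words :: "'a set \<Rightarrow> nat \<Rightarrow> 'a list set" where
  "words A n = {xs. set xs \<subseteq> A \<and> length xs = n}"

text \<open>The length is a parameter, not read off a list, so that products and quotients of letter
  weights combine without hypotheses on lengths.\<close>

definition pr1 :: "nat \<Rightarrow> ('a \<Rightarrow> real) \<Rightarrow> 'a list \<Rightarrow> real" where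
  "pr1 n f xs = (\<Prod>i<n. f (xs ! i))"
definition pr2 :: "nat \<Rightarrow> ('a \<Rightarrow> 'b \<Rightarrow> real) \<Rightarrow> 'a list \<Rightarrow> 'b list \<Rightarrow> real" where
  "pr2 n f xs ys = (\<Prod>i<n. f (xs ! i) (ys ! i))"
definition pr3 :: "nat \<Rightarrow> ('a \<Rightarrow> 'b \<Rightarrow> 'c \<Rightarrow> real) \<Rightarrow> 'a list \<Rightarrow> 'b list \<Rightarrow> 'c list \<Rightarrow> real" where
  "pr3 n f xs ys zs = (\<Prod>i<n. f (xs ! i) (ys ! i) (zs ! i))"

lemma finite_words: "finite A \<Longrightarrow> finite (words A n)"
  unfolding words_def by (rule finite_lists_length_eq)

lemma words_nth: "xs \<in> words A n \<Longrightarrow> i < n \<Longrightarrow> xs ! i \<in> A"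
  by (auto simp: words_def)

lemma words_length: "xs \<in> words A n \<Longrightarrow> length xs = n"
  by (simp add: words_def)

lemma seqs_eq_words: "seqs n = words UNIV n"
  by (simp add: seqs_def words_def)

lemma sum_words_Suc:
  "(\<Sum>xs\<in>words A (Suc n). F xs) = (\<Sum>xs\<in>words A n. \<Sum>x\<in>A. F (xs @ [x]))"
proof -
  have "(\<Sum>xs\<in>words A (Suc n). F xs) = (\<Sum>w\<in>words A n \<times> A. F (fst w @ [snd w]))"
  proof (rule sum.reindex_bij_witness[of _ "\<lambda>w. fst w @ [snd w]" "\<lambda>xs. (butlast xs, last xs)"])
    fix xs assume xs: "xs \<in> words A (Suc n)"
    then have ne: "xs \<noteq> []" by (auto simp: words_def)
    then show "fst (butlast xs, last xs) @ [snd (butlast xs, last xs)] = xs"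
      "F (fst (butlast xs, last xs) @ [snd (butlast xs, last xs)]) = F xs" by simp_all
    have "set (butlast xs) \<subseteq> set xs" "last xs \<in> set xs"
      using ne by (auto dest: in_set_butlastD)
    then show "(butlast xs, last xs) \<in> words A n \<times> A"
      using xs by (auto simp: words_def)
  qed (auto simp: words_def)
  then show ?thesis by (simp add: sum.cartesian_product split_def)
qed

text \<open>The distributive law, by splitting off the last letter. \<open>g\<close> depends on the
  position because other words enter as fixed parameters.\<close>

lemma sum_words_prod:
  "(\<Sum>xs\<in>words A n. \<Prod>i<n. g i (xs ! i)) = (\<Prod>i<n. \<Sum>x\<in>A. g i x :: real)"
proof (induction n)
  case 0
  have "words A 0 = {[]}" by (auto simp: words_def)
  then show ?case by simp
next
  case (Suc n)
  have "(\<Sum>xs\<in>words A (Suc n). \<Prod>i<Suc n. g i (xs ! i))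
      = (\<Sum>xs\<in>words A n. \<Sum>x\<in>A. (\<Prod>i<n. g i (xs ! i)) * g n x)"
    unfolding sum_words_Suc
    by (intro sum.cong refl) (auto simp: words_def nth_append intro!: prod.cong)
  also have "\<dots> = (\<Prod>i<Suc n. \<Sum>x\<in>A. g i x)"
    by (simp add: Suc.IH flip: sum_distrib_left sum_distrib_right)
  finally show ?case .
qed

lemma sum_words_pair:
  "(\<Sum>xs\<in>words A n. \<Sum>ys\<in>words B n. F xs ys) = (\<Sum>ws\<in>words (A \<times> B) n. F (map fst ws) (map snd ws))"
proof -
  have "(\<Sum>ws\<in>words (A \<times> B) n. F (map fst ws) (map snd ws)) = (\<Sum>w\<in>words A n \<times> words B n. F (fst w) (snd w))"
  proof (rule sum.reindex_bij_witness[of _ "\<lambda>w. zip (fst w) (snd w)" "\<lambda>ws. (map fst ws, map snd ws)"])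
    fix ws assume "ws \<in> words (A \<times> B) n"
    then show "(map fst ws, map snd ws) \<in> words A n \<times> words B n" by (auto simp: words_def)
  next
    fix w assume "w \<in> words A n \<times> words B n"
    then show "zip (fst w) (snd w) \<in> words (A \<times> B) n"
      by (auto simp: words_def elim!: in_set_zipE)
  qed (auto simp: words_def zip_map_fst_snd)
  then show ?thesis by (simp add: sum.cartesian_product split_def)
qed

text \<open>The moment function \<open>\<phi>\<close> equals 1 at 0, where its derivative is
  \<open>ln 2\<close> times the mean of \<open>log 2 (r a) - c\<close>, a negative number; so it
  dips below 1 just to the right of 0.\<close>

lemma chernoff_exponent:
  fixes P r :: "'a \<Rightarrow> real"
  assumes A: "finite A" and P0: "\<And>a. a \<in> A \<Longrightarrow> 0 \<le> P a" and P1: "(\<Sum>a\<in>A. P a) = 1"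
    and r: "\<And>a. a \<in> A \<Longrightarrow> P a > 0 \<Longrightarrow> r a > 0"
    and less: "(\<Sum>a\<in>A. P a * log 2 (r a)) < c"
  shows "\<exists>\<rho>>0. (\<Sum>a\<in>A. P a * (r a / 2 powr c) powr \<rho>) < 1"
proof -
  \<comment> \<open>Off the support \<open>r\<close> may vanish; there the base has no logarithm,
    and \<open>0 powr 0\<close> is 0 rather than 1.\<close>
  define B where "B = {a \<in> A. P a > 0}"
  have restrict: "(\<Sum>a\<in>B. P a * g a) = (\<Sum>a\<in>A. P a * g a)" for g
    unfolding B_def using A P0 by (intro sum.mono_neutral_left) (auto simp: less_le)
  define \<phi> where "\<phi> \<rho> = (\<Sum>a\<in>B. P a * (r a / 2 powr c) powr \<rho>)" for \<rho>
  have pos: "r a / 2 powr c > 0" if "a \<in> B" for a using r that by (auto simp: B_def)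
  have "(\<phi> has_real_derivative (\<Sum>a\<in>B. P a * (ln (r a / 2 powr c) * (r a / 2 powr c) powr 0))) (at 0)"
    unfolding \<phi>_def
    by (rule derivative_eq_intros refl | use pos in force)+ (use pos in \<open>auto simp: mult.commute intro!: sum.cong\<close>)
  moreover have "(\<Sum>a\<in>B. P a * (ln (r a / 2 powr c) * (r a / 2 powr c) powr 0)) < 0"
  proof -
    have "(\<Sum>a\<in>B. P a * (ln (r a / 2 powr c) * (r a / 2 powr c) powr 0))
        = (\<Sum>a\<in>B. P a * (ln 2 * (log 2 (r a) - c)))"
    proof (intro sum.cong refl)
      fix a assume a: "a \<in> B"
      have "ln (r a / 2 powr c) = ln 2 * (log 2 (r a) - c)"
        using pos[OF a] by (simp add: zero_less_divide_iff ln_div ln_powr log_def algebra_simps)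
      then show "P a * (ln (r a / 2 powr c) * (r a / 2 powr c) powr 0) = P a * (ln 2 * (log 2 (r a) - c))"
        using pos[OF a] by (simp add: zero_less_divide_iff)
    qed
    also have "\<dots> = ln 2 * ((\<Sum>a\<in>A. P a * log 2 (r a)) - c * (\<Sum>a\<in>A. P a))"
      unfolding restrict by (simp add: right_diff_distrib sum_subtractf sum_distrib_left algebra_simps)
    also have "\<dots> < 0" using less by (simp add: P1 mult_pos_neg)
    finally show ?thesis .
  qed
  ultimately obtain d where d: "d > 0" "\<And>h. 0 < h \<Longrightarrow> h < d \<Longrightarrow> \<phi> (0 + h) < \<phi> 0"
    using DERIV_neg_dec_right by blast
  have "\<phi> 0 = (\<Sum>a\<in>B. P a * 1)"
    unfolding \<phi>_def by (intro sum.cong refl) (use pos in force)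
  then have "\<phi> 0 = 1" using restrict[of "\<lambda>_. 1"] P1 by simp
  then have "\<phi> (d / 2) < 1" using d(2)[of "d / 2"] d(1) by simp
  then show ?thesis
    using d(1) unfolding \<phi>_def restrict by (intro exI[of _ "d / 2"]) auto
qed

text \<open>Markov's inequality for the power \<open>\<rho>\<close> of the likelihood product, whose
  mean factorises into \<open>\<kappa> ^ n\<close>. \<open>ev\<close> is quantified after
  \<open>\<kappa>\<close> and need imply the threshold only on words of positive probability, so
  quotients with zero denominator never have to be interpreted.\<close>

lemma iid_tail1:
  fixes P r :: "'a \<Rightarrow> real"
  assumes A: "finite A" and P0: "\<And>a. a \<in> A \<Longrightarrow> 0 \<le> P a" and P1: "(\<Sum>a\<in>A. P a) = 1"
    and r0: "\<And>a. a \<in> A \<Longrightarrow> 0 \<le> r a"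
    and r: "\<And>a. a \<in> A \<Longrightarrow> P a > 0 \<Longrightarrow> r a > 0"
    and less: "(\<Sum>a\<in>A. P a * log 2 (r a)) < c"
  shows "\<exists>\<kappa>. 0 \<le> \<kappa> \<and> \<kappa> < 1 \<and> (\<forall>n ev.
     (\<forall>xs\<in>words A n. pr1 n P xs > 0 \<longrightarrow> ev xs \<longrightarrow> 2 powr (n * c) \<le> pr1 n r xs) \<longrightarrow>
     (\<Sum>xs\<in>words A n. pr1 n P xs * of_bool (ev xs)) \<le> \<kappa> ^ n)"
proof -
  from chernoff_exponent[OF A P0 P1 r less] obtain \<rho> where \<rho>: "\<rho> > 0"
    and lt: "(\<Sum>a\<in>A. P a * (r a / 2 powr c) powr \<rho>) < 1" by auto
  define \<kappa> where "\<kappa> = (\<Sum>a\<in>A. P a * (r a / 2 powr c) powr \<rho>)"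
  have "0 \<le> \<kappa>" unfolding \<kappa>_def by (intro sum_nonneg mult_nonneg_nonneg P0) auto
  moreover have "(\<Sum>xs\<in>words A n. pr1 n P xs * of_bool (ev xs)) \<le> \<kappa> ^ n"
    if ev: "\<forall>xs\<in>words A n. pr1 n P xs > 0 \<longrightarrow> ev xs \<longrightarrow> 2 powr (n * c) \<le> pr1 n r xs" for n ev
  proof -
    have "(\<Sum>xs\<in>words A n. pr1 n P xs * of_bool (ev xs))
        \<le> (\<Sum>xs\<in>words A n. \<Prod>i<n. P (xs ! i) * (r (xs ! i) / 2 powr c) powr \<rho>)"
    proof (intro sum_mono)
      fix xs assume xs: "xs \<in> words A n"
      have P: "0 \<le> pr1 n P xs" unfolding pr1_def by (intro prod_nonneg) (auto intro: P0 words_nth[OF xs])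
      have eq: "(\<Prod>i<n. P (xs ! i) * (r (xs ! i) / 2 powr c) powr \<rho>)
          = pr1 n P xs * (pr1 n r xs / 2 powr (n * c)) powr \<rho>"
      proof -
        have "(\<Prod>i<n. (r (xs ! i) / 2 powr c) powr \<rho>) = (\<Prod>i<n. r (xs ! i) / 2 powr c) powr \<rho>"
          using r0 words_nth[OF xs] by (simp add: prod_powr_distrib)
        also have "(\<Prod>i<n. r (xs ! i) / 2 powr c) = pr1 n r xs / 2 powr (n * c)"
          by (simp add: pr1_def prod_dividef powr_realpow[symmetric] powr_powr mult.commute)
        finally show ?thesis by (simp add: pr1_def prod.distrib)
      qed
      have "of_bool (ev xs) \<le> (pr1 n r xs / 2 powr (n * c)) powr \<rho>" if "pr1 n P xs > 0"
        using ev xs that \<rho> by (auto intro!: ge_one_powr_ge_zero)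
      then show "pr1 n P xs * of_bool (ev xs) \<le> (\<Prod>i<n. P (xs ! i) * (r (xs ! i) / 2 powr c) powr \<rho>)"
        unfolding eq using P by (cases "pr1 n P xs = 0") (auto intro!: mult_left_mono)
    qed
    also have "\<dots> = \<kappa> ^ n" 
      using sum_words_prod[where n = n and A = A and g = "\<lambda>_ a. P a * (r a / 2 powr c) powr \<rho>"] by (simp add: \<kappa>_def)
    finally show ?thesis .
  qed
  ultimately show ?thesis using lt by (intro exI[of _ \<kappa>]) (auto simp: \<kappa>_def)
qed

text \<open>Two words of equal length are one word over the product alphabet, which reduces this to
  \<open>iid_tail1\<close>; \<open>iid_tail3\<close> groups its last two words in the same
  way.\<close>

lemma iid_tail2:
  fixes P r :: "'a \<Rightarrow> 'b \<Rightarrow> real"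
  assumes A: "finite A" "finite B" and P0: "\<And>a b. a \<in> A \<Longrightarrow> b \<in> B \<Longrightarrow> 0 \<le> P a b"
    and P1: "(\<Sum>a\<in>A. \<Sum>b\<in>B. P a b) = 1"
    and r0: "\<And>a b. a \<in> A \<Longrightarrow> b \<in> B \<Longrightarrow> 0 \<le> r a b"
    and r: "\<And>a b. a \<in> A \<Longrightarrow> b \<in> B \<Longrightarrow> P a b > 0 \<Longrightarrow> r a b > 0"
    and less: "(\<Sum>a\<in>A. \<Sum>b\<in>B. P a b * log 2 (r a b)) < c"
  shows "\<exists>\<kappa>. 0 \<le> \<kappa> \<and> \<kappa> < 1 \<and> (\<forall>n ev.
     (\<forall>xs\<in>words A n. \<forall>ys\<in>words B n. pr2 n P xs ys > 0 \<longrightarrow> ev xs ys \<longrightarrow> 2 powr (n * c) \<le> pr2 n r xs ys) \<longrightarrow>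
     (\<Sum>xs\<in>words A n. \<Sum>ys\<in>words B n. pr2 n P xs ys * of_bool (ev xs ys)) \<le> \<kappa> ^ n)"
proof -
  let ?P = "\<lambda>(a, b). P a b" and ?r = "\<lambda>(a, b). r a b"
  have "\<exists>\<kappa>. 0 \<le> \<kappa> \<and> \<kappa> < 1 \<and> (\<forall>n ev.
     (\<forall>ws\<in>words (A \<times> B) n. pr1 n ?P ws > 0 \<longrightarrow> ev ws \<longrightarrow> 2 powr (n * c) \<le> pr1 n ?r ws) \<longrightarrow>
     (\<Sum>ws\<in>words (A \<times> B) n. pr1 n ?P ws * of_bool (ev ws)) \<le> \<kappa> ^ n)"
    using assms by (intro iid_tail1) (auto simp: sum.cartesian_product split_def)
  then obtain \<kappa> where \<kappa>: "0 \<le> \<kappa>" "\<kappa> < 1" and *: "\<And>n ev.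
     (\<forall>ws\<in>words (A \<times> B) n. pr1 n ?P ws > 0 \<longrightarrow> ev ws \<longrightarrow> 2 powr (n * c) \<le> pr1 n ?r ws) \<Longrightarrow>
     (\<Sum>ws\<in>words (A \<times> B) n. pr1 n ?P ws * of_bool (ev ws)) \<le> \<kappa> ^ n" by blast
  have pr: "pr2 n f (map fst ws) (map snd ws) = pr1 n (\<lambda>(a, b). f a b) ws" if "ws \<in> words (A \<times> B) n"
    for n ws and f :: "'a \<Rightarrow> 'b \<Rightarrow> real"
    using that by (auto simp: pr1_def pr2_def words_def split_def intro!: prod.cong)
  have w: "map fst ws \<in> words A n" "map snd ws \<in> words B n" if "ws \<in> words (A \<times> B) n" for n ws
    using that by (auto simp: words_def)
  show ?thesis
  proof (intro exI[of _ \<kappa>] conjI \<kappa> allI impI)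
    fix n ev
    assume "\<forall>xs\<in>words A n. \<forall>ys\<in>words B n. pr2 n P xs ys > 0 \<longrightarrow> ev xs ys \<longrightarrow> 2 powr (n * c) \<le> pr2 n r xs ys"
    then have "\<forall>ws\<in>words (A \<times> B) n. pr1 n ?P ws > 0 \<longrightarrow> ev (map fst ws) (map snd ws) \<longrightarrow> 2 powr (n * c) \<le> pr1 n ?r ws"
      using w by (auto simp: pr[symmetric])
    from *[OF this] show "(\<Sum>xs\<in>words A n. \<Sum>ys\<in>words B n. pr2 n P xs ys * of_bool (ev xs ys)) \<le> \<kappa> ^ n"
      unfolding sum_words_pair by (simp add: pr cong: sum.cong)
  qed
qed

lemma iid_tail3:
  fixes P r :: "'a \<Rightarrow> 'b \<Rightarrow> 'c \<Rightarrow> real"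
  assumes A: "finite A" "finite B" "finite C"
    and P0: "\<And>a b d. a \<in> A \<Longrightarrow> b \<in> B \<Longrightarrow> d \<in> C \<Longrightarrow> 0 \<le> P a b d"
    and P1: "(\<Sum>a\<in>A. \<Sum>b\<in>B. \<Sum>d\<in>C. P a b d) = 1"
    and r0: "\<And>a b d. a \<in> A \<Longrightarrow> b \<in> B \<Longrightarrow> d \<in> C \<Longrightarrow> 0 \<le> r a b d"
    and r: "\<And>a b d. a \<in> A \<Longrightarrow> b \<in> B \<Longrightarrow> d \<in> C \<Longrightarrow> P a b d > 0 \<Longrightarrow> r a b d > 0"
    and less: "(\<Sum>a\<in>A. \<Sum>b\<in>B. \<Sum>d\<in>C. P a b d * log 2 (r a b d)) < c"
  shows "\<exists>\<kappa>. 0 \<le> \<kappa> \<and> \<kappa> < 1 \<and> (\<forall>n ev.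
     (\<forall>xs\<in>words A n. \<forall>ys\<in>words B n. \<forall>zs\<in>words C n. pr3 n P xs ys zs > 0 \<longrightarrow> ev xs ys zs \<longrightarrow> 2 powr (n * c) \<le> pr3 n r xs ys zs) \<longrightarrow>
     (\<Sum>xs\<in>words A n. \<Sum>ys\<in>words B n. \<Sum>zs\<in>words C n. pr3 n P xs ys zs * of_bool (ev xs ys zs)) \<le> \<kappa> ^ n)"
proof -
  let ?P = "\<lambda>a (b, d). P a b d" and ?r = "\<lambda>a (b, d). r a b d"
  have "\<exists>\<kappa>. 0 \<le> \<kappa> \<and> \<kappa> < 1 \<and> (\<forall>n ev.
     (\<forall>xs\<in>words A n. \<forall>ws\<in>words (B \<times> C) n. pr2 n ?P xs ws > 0 \<longrightarrow> ev xs ws \<longrightarrow> 2 powr (n * c) \<le> pr2 n ?r xs ws) \<longrightarrow>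
     (\<Sum>xs\<in>words A n. \<Sum>ws\<in>words (B \<times> C) n. pr2 n ?P xs ws * of_bool (ev xs ws)) \<le> \<kappa> ^ n)"
    using assms by (intro iid_tail2) (auto simp: sum.cartesian_product split_def)
  then obtain \<kappa> where \<kappa>: "0 \<le> \<kappa>" "\<kappa> < 1" and *: "\<And>n ev.
     (\<forall>xs\<in>words A n. \<forall>ws\<in>words (B \<times> C) n. pr2 n ?P xs ws > 0 \<longrightarrow> ev xs ws \<longrightarrow> 2 powr (n * c) \<le> pr2 n ?r xs ws) \<Longrightarrow>
     (\<Sum>xs\<in>words A n. \<Sum>ws\<in>words (B \<times> C) n. pr2 n ?P xs ws * of_bool (ev xs ws)) \<le> \<kappa> ^ n" by blast
  have pr: "pr3 n f xs (map fst ws) (map snd ws) = pr2 n (\<lambda>a (b, d). f a b d) xs ws" if "ws \<in> words (B \<times> C) n"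
    for n xs ws and f :: "'a \<Rightarrow> 'b \<Rightarrow> 'c \<Rightarrow> real"
    using that by (auto simp: pr2_def pr3_def words_def split_def intro!: prod.cong)
  have w: "map fst ws \<in> words B n" "map snd ws \<in> words C n" if "ws \<in> words (B \<times> C) n" for n ws
    using that by (auto simp: words_def)
  show ?thesis
  proof (intro exI[of _ \<kappa>] conjI \<kappa> allI impI)
    fix n ev
    assume ev: "\<forall>xs\<in>words A n. \<forall>ys\<in>words B n. \<forall>zs\<in>words C n. pr3 n P xs ys zs > 0 \<longrightarrow> ev xs ys zs
      \<longrightarrow> 2 powr (n * c) \<le> pr3 n r xs ys zs"
    then have "\<forall>xs\<in>words A n. \<forall>ws\<in>words (B \<times> C) n. pr2 n ?P xs ws > 0 \<longrightarrow> ev xs (map fst ws) (map snd ws)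
        \<longrightarrow> 2 powr (n * c) \<le> pr2 n ?r xs ws"
      using w by (auto simp: pr[symmetric])
    from *[OF this] show "(\<Sum>xs\<in>words A n. \<Sum>ys\<in>words B n. \<Sum>zs\<in>words C n. pr3 n P xs ys zs * of_bool (ev xs ys zs)) \<le> \<kappa> ^ n"
      unfolding sum_words_pair[where A = B] by (simp add: pr cong: sum.cong)
  qed
qed

section \<open>Memoryless extensions\<close>

lemma pr1_pos: "(\<And>a. a \<in> A \<Longrightarrow> 0 < f a) \<Longrightarrow> xs \<in> words A n \<Longrightarrow> 0 < pr1 n f xs"
  unfolding pr1_def by (intro prod_pos) (auto intro: words_nth)

context channel_model
begin

text \<open>The memoryless extension satisfies the same axioms, so one-shot coding and inequalities
  such as \<open>q_ge\<close> and \<open>VZ_ge\<close> hold for words without a second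
  proof.\<close>

lemma words_extension:
  "channel_model (words US n) (words SS n) (words YS n) (words ZS n)
     (pr1 n p) (pr2 n v) (pr3 n wy) (pr3 n wz) (pr1 n q) (pr2 n VY) (pr2 n VZ) (pr1 n PY) (pr1 n PZ)"
proof
  show "finite (words US n)" "finite (words SS n)" "finite (words YS n)" "finite (words ZS n)"
    by (auto intro: finite_words fin)
  show "(\<Sum>us\<in>words US n. pr1 n p us) = 1"
    unfolding pr1_def sum_words_prod[where g = "\<lambda>_. p"] by (simp add: p1)
  show "0 \<le> pr1 n p us" if "us \<in> words US n" for us
    unfolding pr1_def using that by (auto intro!: prod_nonneg p0 intro: words_nth)
  show "0 < pr1 n PZ zs" if "zs \<in> words ZS n" for zs
    using that PZ_pos by (rule pr1_pos[rotated])
  show "pr1 n q ss = (\<Sum>us\<in>words US n. pr1 n p us * pr2 n v us ss)" if "ss \<in> words SS n" for ss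
    unfolding pr1_def pr2_def prod.distrib[symmetric] sum_words_prod[where g = "\<lambda>i u. p u * v u (ss ! i)"]
    using that by (intro prod.cong refl q_eq) (auto intro: words_nth)
  show "pr1 n PY ys = (\<Sum>us\<in>words US n. pr1 n p us * pr2 n VY us ys)" if "ys \<in> words YS n" for ys
    unfolding pr1_def pr2_def prod.distrib[symmetric] sum_words_prod[where g = "\<lambda>i u. p u * VY u (ys ! i)"]
    using that by (intro prod.cong refl PY_eq) (auto intro: words_nth)
  show "pr1 n PZ zs = (\<Sum>us\<in>words US n. pr1 n p us * pr2 n VZ us zs)" if "zs \<in> words ZS n" for zs
    unfolding pr1_def pr2_def prod.distrib[symmetric] sum_words_prod[where g = "\<lambda>i u. p u * VZ u (zs ! i)"]
    using that by (intro prod.cong refl PZ_eq) (auto intro: words_nth)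
  fix us assume us: "us \<in> words US n"
  note un = words_nth[OF us]
  show "(\<Sum>ss\<in>words SS n. pr2 n v us ss) = 1"
    unfolding pr2_def sum_words_prod[where g = "\<lambda>i. v (us ! i)"] by (simp add: v1 un)
  show "pr2 n VY us ys = (\<Sum>ss\<in>words SS n. pr2 n v us ss * pr3 n wy us ss ys)" if "ys \<in> words YS n" for ys
    unfolding pr2_def pr3_def prod.distrib[symmetric]
      sum_words_prod[where g = "\<lambda>i s. v (us ! i) s * wy (us ! i) s (ys ! i)"]
    using that by (intro prod.cong refl VY_eq) (auto intro: words_nth un)
  show "pr2 n VZ us zs = (\<Sum>ss\<in>words SS n. pr2 n v us ss * pr3 n wz us ss zs)" if "zs \<in> words ZS n" for zs
    unfolding pr2_def pr3_def prod.distrib[symmetric]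
      sum_words_prod[where g = "\<lambda>i s. v (us ! i) s * wz (us ! i) s (zs ! i)"]
    using that by (intro prod.cong refl VZ_eq) (auto intro: words_nth un)
  fix ss assume ss: "ss \<in> words SS n"
  note sn = words_nth[OF ss]
  show "0 \<le> pr2 n v us ss"
    unfolding pr2_def by (auto intro!: prod_nonneg v0 un sn)
  show "(\<Sum>ys\<in>words YS n. pr3 n wy us ss ys) = 1"
    unfolding pr3_def sum_words_prod[where g = "\<lambda>i. wy (us ! i) (ss ! i)"] by (simp add: wy1 un sn)
  show "(\<Sum>zs\<in>words ZS n. pr3 n wz us ss zs) = 1"
    unfolding pr3_def sum_words_prod[where g = "\<lambda>i. wz (us ! i) (ss ! i)"] by (simp add: wz1 un sn)
  show "0 \<le> pr3 n wy us ss ys" if "ys \<in> words YS n" for ys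
    unfolding pr3_def using that by (auto intro!: prod_nonneg wy0 un sn intro: words_nth)
  show "0 \<le> pr3 n wz us ss zs" if "zs \<in> words ZS n" for zs
    unfolding pr3_def using that by (auto intro!: prod_nonneg wz0 un sn intro: words_nth)
qed

section \<open>Single-letter informations and exponential tails of their densities\<close>

definition IY where "IY = (\<Sum>u\<in>US. \<Sum>y\<in>YS. p u * VY u y * log 2 (VY u y / PY y))"
definition IZ where "IZ = (\<Sum>u\<in>US. \<Sum>z\<in>ZS. p u * VZ u z * log 2 (VZ u z / PZ z))"
definition IS where "IS = (\<Sum>u\<in>US. \<Sum>s\<in>SS. p u * v u s * log 2 (v u s / q s))"

lemma pVY1: "(\<Sum>u\<in>US. \<Sum>y\<in>YS. p u * VY u y) = 1"
  by (simp add: VY1 p1 flip: sum_distrib_left)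
lemma pVZ1: "(\<Sum>u\<in>US. \<Sum>z\<in>ZS. p u * VZ u z) = 1"
  by (simp add: VZ1 p1 flip: sum_distrib_left)
lemma pv1: "(\<Sum>u\<in>US. \<Sum>s\<in>SS. p u * v u s) = 1"
  by (simp add: v1 p1 flip: sum_distrib_left)

text \<open>A joint weight is at most its marginal, so the denominators in the information densities
  are positive wherever the joint law is.\<close>

lemma PY_ge: "u \<in> US \<Longrightarrow> y \<in> YS \<Longrightarrow> p u * VY u y \<le> PY y"
  unfolding PY_eq by (rule member_le_sum) (auto simp: p0 VY0 fin)
lemma q_ge: "u \<in> US \<Longrightarrow> s \<in> SS \<Longrightarrow> p u * v u s \<le> q s"
  unfolding q_eq by (rule member_le_sum) (auto simp: p0 v0 fin)
lemma VZ_ge: "u \<in> US \<Longrightarrow> s \<in> SS \<Longrightarrow> z \<in> ZS \<Longrightarrow> v u s * wz u s z \<le> VZ u z"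
  unfolding VZ_eq by (rule member_le_sum[where f = "\<lambda>s. v u s * wz u s z"]) (auto simp: v0 wz0 fin)

text \<open>Gibbs' inequality from \<open>ln x \<le> x - 1\<close>. It makes the index rate
  nonnegative.\<close>

lemma IS_nonneg: "0 \<le> IS"
proof -
  have "0 = (\<Sum>u\<in>US. \<Sum>s\<in>SS. p u * v u s - p u * q s)"
    using pv1 by (simp add: sum_subtractf q1 p1 flip: sum_distrib_left)
  also have "\<dots> \<le> (\<Sum>u\<in>US. \<Sum>s\<in>SS. ln 2 * (p u * v u s * log 2 (v u s / q s)))"
  proof (intro sum_mono)
    fix u s assume us: "u \<in> US" "s \<in> SS"
    show "p u * v u s - p u * q s \<le> ln 2 * (p u * v u s * log 2 (v u s / q s))"
    proof (cases "p u * v u s = 0")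
      case True
      then show ?thesis using p0[OF us(1)] q0[OF us(2)] by auto
    next
      case False
      then have pos: "p u > 0" "v u s > 0" using p0[OF us(1)] v0[OF us] by (auto simp: less_le)
      then have q: "q s > 0" using q_ge[OF us] by (smt (verit) mult_pos_pos)
      have "1 - q s / v u s \<le> ln (v u s / q s)"
        using ln_le_minus_one[of "q s / v u s"] pos q by (simp add: ln_div)
      then have "p u * v u s * (1 - q s / v u s) \<le> p u * v u s * ln (v u s / q s)"
        using pos by (intro mult_left_mono) auto
      moreover have "p u * v u s * (1 - q s / v u s) = p u * v u s - p u * q s"
        using pos by (simp add: field_simps)
      ultimately show ?thesis by (simp add: log_def)
    qed
  qed
  also have "\<dots> = ln 2 * IS" by (simp add: IS_def sum_distrib_left)
  finally show ?thesis by (simp add: zero_le_mult_iff)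
qed

text \<open>A lower tail: it becomes an upper tail, as \<open>iid_tail2\<close> demands, for the
  reciprocal ratio \<open>PY y / VY u y\<close>, whose mean logarithm is
  \<open>- IY\<close>.\<close>

lemma tail_Y:
  assumes "c < IY"
  shows "\<exists>\<kappa>. 0 \<le> \<kappa> \<and> \<kappa> < 1 \<and> (\<forall>n. (\<Sum>us\<in>words US n. \<Sum>ys\<in>words YS n.
     pr1 n p us * pr2 n VY us ys * of_bool (pr2 n VY us ys \<le> 2 powr (n * c) * pr1 n PY ys)) \<le> \<kappa> ^ n)"
proof -
  have pos: "VY u y > 0 \<and> PY y > 0" if "u \<in> US" "y \<in> YS" "p u * VY u y > 0" for u y
    using PY_ge[OF that(1,2)] that VY0[OF that(1,2)] by (metis less_le mult_zero_right order.strict_trans2)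
  have mean: "(\<Sum>u\<in>US. \<Sum>y\<in>YS. p u * VY u y * log 2 (PY y / VY u y)) = - IY"
    unfolding IY_def sum_negf[symmetric]
  proof (intro sum.cong refl)
    fix u y assume uy: "u \<in> US" "y \<in> YS"
    show "p u * VY u y * log 2 (PY y / VY u y) = - (p u * VY u y * log 2 (VY u y / PY y))"
    proof (cases "p u * VY u y = 0")
      case False
      then have "p u * VY u y > 0" using p0 VY0 uy by (simp add: less_le)
      from pos[OF uy this] show ?thesis by (simp add: log_divide algebra_simps)
    qed auto
  qed
  have "\<exists>\<kappa>. 0 \<le> \<kappa> \<and> \<kappa> < 1 \<and> (\<forall>n ev.
     (\<forall>us\<in>words US n. \<forall>ys\<in>words YS n. pr2 n (\<lambda>u y. p u * VY u y) us ys > 0 \<longrightarrow> ev us ys \<longrightarrow>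
        2 powr (n * - c) \<le> pr2 n (\<lambda>u y. PY y / VY u y) us ys) \<longrightarrow>
     (\<Sum>us\<in>words US n. \<Sum>ys\<in>words YS n. pr2 n (\<lambda>u y. p u * VY u y) us ys * of_bool (ev us ys)) \<le> \<kappa> ^ n)"
    using assms pos by (intro iid_tail2) (auto simp: fin p0 VY0 PY0 pVY1 mean)
  then obtain \<kappa> where \<kappa>: "0 \<le> \<kappa>" "\<kappa> < 1" and *: "\<forall>n ev.
     (\<forall>us\<in>words US n. \<forall>ys\<in>words YS n. pr2 n (\<lambda>u y. p u * VY u y) us ys > 0 \<longrightarrow> ev us ys \<longrightarrow>
        2 powr (n * - c) \<le> pr2 n (\<lambda>u y. PY y / VY u y) us ys) \<longrightarrow>
     (\<Sum>us\<in>words US n. \<Sum>ys\<in>words YS n. pr2 n (\<lambda>u y. p u * VY u y) us ys * of_bool (ev us ys)) \<le> \<kappa> ^ n"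
    by (elim exE conjE) (rule that)
  have pr: "pr2 n (\<lambda>u y. p u * VY u y) us ys = pr1 n p us * pr2 n VY us ys" for n us ys
    by (simp add: pr1_def pr2_def prod.distrib)
  have pr': "pr2 n (\<lambda>u y. PY y / VY u y) us ys = pr1 n PY ys / pr2 n VY us ys" for n us ys
    by (simp add: pr1_def pr2_def prod_dividef)
  show ?thesis
  proof (intro exI[of _ \<kappa>] conjI \<kappa> allI)
    fix n
    interpret ext: channel_model "words US n" "words SS n" "words YS n" "words ZS n"
      "pr1 n p" "pr2 n v" "pr3 n wy" "pr3 n wz" "pr1 n q" "pr2 n VY" "pr2 n VZ" "pr1 n PY" "pr1 n PZ"
      by (rule words_extension)
    show "(\<Sum>us\<in>words US n. \<Sum>ys\<in>words YS n.
     pr1 n p us * pr2 n VY us ys * of_bool (pr2 n VY us ys \<le> 2 powr (n * c) * pr1 n PY ys)) \<le> \<kappa> ^ n"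
      unfolding pr[symmetric]
    proof (rule *[rule_format])
      fix us ys assume w: "us \<in> words US n" "ys \<in> words YS n"
        and P: "pr2 n (\<lambda>u y. p u * VY u y) us ys > 0"
        and le: "pr2 n VY us ys \<le> 2 powr (n * c) * pr1 n PY ys"
      have "pr2 n VY us ys > 0" using P ext.p0[OF w(1)] ext.VY0[OF w] by (auto simp: pr zero_less_mult_iff)
      then show "2 powr (n * - c) \<le> pr2 n (\<lambda>u y. PY y / VY u y) us ys"
        using le by (simp add: pr' powr_minus field_simps)
    qed
  qed
qed

text \<open>An upper tail of the density with mean \<open>IS\<close>. The event is closed so that
  strict events with larger thresholds, produced by rounding up the number of indices, are contained
  in it.\<close>

lemma tail_S:
  assumes "IS < c"
  shows "\<exists>\<kappa>. 0 \<le> \<kappa> \<and> \<kappa> < 1 \<and> (\<forall>n. (\<Sum>us\<in>words US n. \<Sum>ss\<in>words SS n.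
     pr1 n p us * pr2 n v us ss * of_bool (pr2 n v us ss \<ge> 2 powr (n * c) * pr1 n q ss)) \<le> \<kappa> ^ n)"
proof -
  have pos: "v u s > 0 \<and> q s > 0" if "u \<in> US" "s \<in> SS" "p u * v u s > 0" for u s
    using q_ge[OF that(1,2)] that v0[OF that(1,2)] by (metis less_le mult_zero_right order.strict_trans2)
  have "\<exists>\<kappa>. 0 \<le> \<kappa> \<and> \<kappa> < 1 \<and> (\<forall>n ev.
     (\<forall>us\<in>words US n. \<forall>ss\<in>words SS n. pr2 n (\<lambda>u s. p u * v u s) us ss > 0 \<longrightarrow> ev us ss \<longrightarrow>
        2 powr (n * c) \<le> pr2 n (\<lambda>u s. v u s / q s) us ss) \<longrightarrow>
     (\<Sum>us\<in>words US n. \<Sum>ss\<in>words SS n. pr2 n (\<lambda>u s. p u * v u s) us ss * of_bool (ev us ss)) \<le> \<kappa> ^ n)"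
    using assms pos by (intro iid_tail2) (auto simp: fin p0 v0 q0 pv1 IS_def)
  then obtain \<kappa> where \<kappa>: "0 \<le> \<kappa>" "\<kappa> < 1" and *: "\<forall>n ev.
     (\<forall>us\<in>words US n. \<forall>ss\<in>words SS n. pr2 n (\<lambda>u s. p u * v u s) us ss > 0 \<longrightarrow> ev us ss \<longrightarrow>
        2 powr (n * c) \<le> pr2 n (\<lambda>u s. v u s / q s) us ss) \<longrightarrow>
     (\<Sum>us\<in>words US n. \<Sum>ss\<in>words SS n. pr2 n (\<lambda>u s. p u * v u s) us ss * of_bool (ev us ss)) \<le> \<kappa> ^ n"
    by (elim exE conjE) (rule that)
  have pr: "pr2 n (\<lambda>u s. p u * v u s) us ss = pr1 n p us * pr2 n v us ss" for n us ss
    by (simp add: pr1_def pr2_def prod.distrib)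
  have pr': "pr2 n (\<lambda>u s. v u s / q s) us ss = pr2 n v us ss / pr1 n q ss" for n us ss
    by (simp add: pr1_def pr2_def prod_dividef)
  show ?thesis
  proof (intro exI[of _ \<kappa>] conjI \<kappa> allI)
    fix n
    interpret ext: channel_model "words US n" "words SS n" "words YS n" "words ZS n"
      "pr1 n p" "pr2 n v" "pr3 n wy" "pr3 n wz" "pr1 n q" "pr2 n VY" "pr2 n VZ" "pr1 n PY" "pr1 n PZ"
      by (rule words_extension)
    show "(\<Sum>us\<in>words US n. \<Sum>ss\<in>words SS n.
     pr1 n p us * pr2 n v us ss * of_bool (pr2 n v us ss \<ge> 2 powr (n * c) * pr1 n q ss)) \<le> \<kappa> ^ n"
      unfolding pr[symmetric]
    proof (rule *[rule_format])
      fix us ss assume w: "us \<in> words US n" "ss \<in> words SS n"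
        and P: "pr2 n (\<lambda>u s. p u * v u s) us ss > 0"
        and le: "pr2 n v us ss \<ge> 2 powr (n * c) * pr1 n q ss"
      have "pr1 n q ss > 0" using P ext.q_ge[OF w] by (simp add: pr)
      then show "2 powr (n * c) \<le> pr2 n (\<lambda>u s. v u s / q s) us ss"
        using le by (simp add: pr' field_simps)
    qed
  qed
qed

lemma tail_Z:
  assumes "IZ < c"
  shows "\<exists>\<kappa>. 0 \<le> \<kappa> \<and> \<kappa> < 1 \<and> (\<forall>n. (\<Sum>us\<in>words US n. \<Sum>zs\<in>words ZS n.
     pr1 n p us * pr2 n VZ us zs * of_bool (pr2 n VZ us zs \<ge> 2 powr (n * c) * pr1 n PZ zs)) \<le> \<kappa> ^ n)"
proof -
  have pos: "VZ u z > 0 \<and> PZ z > 0" if "u \<in> US" "z \<in> ZS" "p u * VZ u z > 0" for u z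
    using PZ_pos[of z] that VZ0[of u z] p0[of u] by (auto simp: zero_less_mult_iff)
  have "\<exists>\<kappa>. 0 \<le> \<kappa> \<and> \<kappa> < 1 \<and> (\<forall>n ev.
     (\<forall>us\<in>words US n. \<forall>zs\<in>words ZS n. pr2 n (\<lambda>u z. p u * VZ u z) us zs > 0 \<longrightarrow> ev us zs \<longrightarrow>
        2 powr (n * c) \<le> pr2 n (\<lambda>u z. VZ u z / PZ z) us zs) \<longrightarrow>
     (\<Sum>us\<in>words US n. \<Sum>zs\<in>words ZS n. pr2 n (\<lambda>u z. p u * VZ u z) us zs * of_bool (ev us zs)) \<le> \<kappa> ^ n)"
    using assms pos by (intro iid_tail2) (auto simp: fin p0 VZ0 less_imp_le[OF PZ_pos] pVZ1 IZ_def)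
  then obtain \<kappa> where \<kappa>: "0 \<le> \<kappa>" "\<kappa> < 1" and *: "\<forall>n ev.
     (\<forall>us\<in>words US n. \<forall>zs\<in>words ZS n. pr2 n (\<lambda>u z. p u * VZ u z) us zs > 0 \<longrightarrow> ev us zs \<longrightarrow>
        2 powr (n * c) \<le> pr2 n (\<lambda>u z. VZ u z / PZ z) us zs) \<longrightarrow>
     (\<Sum>us\<in>words US n. \<Sum>zs\<in>words ZS n. pr2 n (\<lambda>u z. p u * VZ u z) us zs * of_bool (ev us zs)) \<le> \<kappa> ^ n"
    by (elim exE conjE) (rule that)
  have pr: "pr2 n (\<lambda>u z. p u * VZ u z) us zs = pr1 n p us * pr2 n VZ us zs" for n us zs
    by (simp add: pr1_def pr2_def prod.distrib)
  have pr': "pr2 n (\<lambda>u z. VZ u z / PZ z) us zs = pr2 n VZ us zs / pr1 n PZ zs" for n us zs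
    by (simp add: pr1_def pr2_def prod_dividef)
  show ?thesis
  proof (intro exI[of _ \<kappa>] conjI \<kappa> allI)
    fix n
    show "(\<Sum>us\<in>words US n. \<Sum>zs\<in>words ZS n.
     pr1 n p us * pr2 n VZ us zs * of_bool (pr2 n VZ us zs \<ge> 2 powr (n * c) * pr1 n PZ zs)) \<le> \<kappa> ^ n"
      unfolding pr[symmetric]
    proof (rule *[rule_format])
      fix us zs assume w: "us \<in> words US n" "zs \<in> words ZS n"
        and le: "pr2 n VZ us zs \<ge> 2 powr (n * c) * pr1 n PZ zs"
      have "pr1 n PZ zs > 0" using w PZ_pos by (auto intro: pr1_pos)
      then show "2 powr (n * c) \<le> pr2 n (\<lambda>u z. VZ u z / PZ z) us zs"
        using le by (simp add: pr' field_simps)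
    qed
  qed
qed

text \<open>
  Pointwise \<open>q s * wz u s z / PZ z \<le> (VZ u z / PZ z) * (q s / v u s)\<close>, because
  \<open>v u s * wz u s z / VZ u z\<close> is the conditional probability \<open>P_{S|U,Z}\<close>. This replaces an
  estimate of \<open>I(U,S;Z) - H(S)\<close>.
\<close>

lemma tail_B:
  assumes "IZ - IS < c"
  shows "\<exists>\<kappa>. 0 \<le> \<kappa> \<and> \<kappa> < 1 \<and> (\<forall>n. (\<Sum>us\<in>words US n. \<Sum>ss\<in>words SS n. \<Sum>zs\<in>words ZS n.
     pr1 n p us * pr2 n v us ss * pr3 n wz us ss zs *
     of_bool (pr1 n q ss * pr3 n wz us ss zs \<ge> 2 powr (n * c) * pr1 n PZ zs)) \<le> \<kappa> ^ n)"
proof -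
  define r where "r u s z = (VZ u z * q s) / (PZ z * v u s)" for u s z
  have pos: "p u > 0 \<and> VZ u z > 0 \<and> PZ z > 0 \<and> q s > 0 \<and> v u s > 0"
    if "u \<in> US" "s \<in> SS" "z \<in> ZS" "p u * v u s * wz u s z > 0" for u s z
  proof -
    have "p u > 0" "v u s > 0" "wz u s z > 0"
      using that p0[of u] v0[of u s] wz0[of u s z] by (auto simp: less_le)
    moreover from this have "0 < p u * v u s" "0 < v u s * wz u s z" by simp_all
    ultimately show ?thesis
      using q_ge[of u s] VZ_ge[of u s z] PZ_pos[of z] that(1-3) by linarith
  qed
  have w0: "0 \<le> p u * v u s * wz u s z" if "u \<in> US" "s \<in> SS" "z \<in> ZS" for u s z
    using that by (simp add: p0 v0 wz0)
  have mean: "(\<Sum>u\<in>US. \<Sum>s\<in>SS. \<Sum>z\<in>ZS. p u * v u s * wz u s z * log 2 (r u s z)) = IZ - IS"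
  proof -
    have "(\<Sum>u\<in>US. \<Sum>s\<in>SS. \<Sum>z\<in>ZS. p u * v u s * wz u s z * log 2 (r u s z))
      = (\<Sum>u\<in>US. \<Sum>s\<in>SS. \<Sum>z\<in>ZS. p u * log 2 (VZ u z / PZ z) * (v u s * wz u s z)
            - p u * v u s * log 2 (v u s / q s) * wz u s z)"
    proof (intro sum.cong refl)
      fix u s z assume usz: "u \<in> US" "s \<in> SS" "z \<in> ZS"
      show "p u * v u s * wz u s z * log 2 (r u s z) = p u * log 2 (VZ u z / PZ z) * (v u s * wz u s z)
            - p u * v u s * log 2 (v u s / q s) * wz u s z"
      proof (cases "p u * v u s * wz u s z = 0")
        case False
        then have "p u * v u s * wz u s z > 0" using w0[OF usz] by linarith
        from pos[OF usz this] show ?thesis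
          by (simp add: r_def log_divide log_mult algebra_simps)
      qed auto
    qed
    also have "\<dots> = (\<Sum>u\<in>US. \<Sum>s\<in>SS. \<Sum>z\<in>ZS. p u * log 2 (VZ u z / PZ z) * (v u s * wz u s z))
            - (\<Sum>u\<in>US. \<Sum>s\<in>SS. \<Sum>z\<in>ZS. p u * v u s * log 2 (v u s / q s) * wz u s z)"
      by (simp only: sum_subtractf)
    also have "(\<Sum>u\<in>US. \<Sum>s\<in>SS. \<Sum>z\<in>ZS. p u * log 2 (VZ u z / PZ z) * (v u s * wz u s z)) = IZ"
    proof -
      have "(\<Sum>u\<in>US. \<Sum>s\<in>SS. \<Sum>z\<in>ZS. p u * log 2 (VZ u z / PZ z) * (v u s * wz u s z))
        = (\<Sum>u\<in>US. \<Sum>z\<in>ZS. \<Sum>s\<in>SS. p u * log 2 (VZ u z / PZ z) * (v u s * wz u s z))"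
        by (intro sum.cong refl sum.swap)
      also have "\<dots> = (\<Sum>u\<in>US. \<Sum>z\<in>ZS. p u * log 2 (VZ u z / PZ z) * VZ u z)"
        by (intro sum.cong refl) (simp add: VZ_eq sum_distrib_left)
      finally show ?thesis by (simp add: IZ_def algebra_simps)
    qed
    also have "(\<Sum>u\<in>US. \<Sum>s\<in>SS. \<Sum>z\<in>ZS. p u * v u s * log 2 (v u s / q s) * wz u s z) = IS"
      unfolding IS_def by (intro sum.cong refl) (simp add: wz1 flip: sum_distrib_left)
    finally show ?thesis .
  qed
  have one: "(\<Sum>u\<in>US. \<Sum>s\<in>SS. \<Sum>z\<in>ZS. p u * v u s * wz u s z) = 1"
    using pv1 by (simp add: wz1 flip: sum_distrib_left)
  have "\<exists>\<kappa>. 0 \<le> \<kappa> \<and> \<kappa> < 1 \<and> (\<forall>n ev.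
     (\<forall>us\<in>words US n. \<forall>ss\<in>words SS n. \<forall>zs\<in>words ZS n. pr3 n (\<lambda>u s z. p u * v u s * wz u s z) us ss zs > 0 \<longrightarrow> ev us ss zs \<longrightarrow>
        2 powr (n * c) \<le> pr3 n r us ss zs) \<longrightarrow>
     (\<Sum>us\<in>words US n. \<Sum>ss\<in>words SS n. \<Sum>zs\<in>words ZS n. pr3 n (\<lambda>u s z. p u * v u s * wz u s z) us ss zs * of_bool (ev us ss zs)) \<le> \<kappa> ^ n)"
  proof (intro iid_tail3 fin w0 one)
    show "(\<Sum>u\<in>US. \<Sum>s\<in>SS. \<Sum>z\<in>ZS. p u * v u s * wz u s z * log 2 (r u s z)) < c"
      using mean assms by simp
    show "0 \<le> r u s z" if "u \<in> US" "s \<in> SS" "z \<in> ZS" for u s z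
      using that by (simp add: r_def VZ0 q0 v0 less_imp_le[OF PZ_pos])
    show "0 < r u s z" if "u \<in> US" "s \<in> SS" "z \<in> ZS" "0 < p u * v u s * wz u s z" for u s z
      using pos[OF that] by (simp add: r_def)
  qed
  then obtain \<kappa> where \<kappa>: "0 \<le> \<kappa>" "\<kappa> < 1" and *: "\<forall>n ev.
     (\<forall>us\<in>words US n. \<forall>ss\<in>words SS n. \<forall>zs\<in>words ZS n. pr3 n (\<lambda>u s z. p u * v u s * wz u s z) us ss zs > 0 \<longrightarrow> ev us ss zs \<longrightarrow>
        2 powr (n * c) \<le> pr3 n r us ss zs) \<longrightarrow>
     (\<Sum>us\<in>words US n. \<Sum>ss\<in>words SS n. \<Sum>zs\<in>words ZS n. pr3 n (\<lambda>u s z. p u * v u s * wz u s z) us ss zs * of_bool (ev us ss zs)) \<le> \<kappa> ^ n"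
    by (elim exE conjE) (rule that)
  have pr: "pr3 n (\<lambda>u s z. p u * v u s * wz u s z) us ss zs = pr1 n p us * pr2 n v us ss * pr3 n wz us ss zs" for n us ss zs
    by (simp add: pr1_def pr2_def pr3_def prod.distrib)
  have pr': "pr3 n r us ss zs = (pr2 n VZ us zs * pr1 n q ss) / (pr1 n PZ zs * pr2 n v us ss)" for n us ss zs
    by (simp add: r_def pr1_def pr2_def pr3_def prod_dividef prod.distrib)
  show ?thesis
  proof (intro exI[of _ \<kappa>] conjI \<kappa> allI)
    fix n
    interpret ext: channel_model "words US n" "words SS n" "words YS n" "words ZS n"
      "pr1 n p" "pr2 n v" "pr3 n wy" "pr3 n wz" "pr1 n q" "pr2 n VY" "pr2 n VZ" "pr1 n PY" "pr1 n PZ"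
      by (rule words_extension)
    show "(\<Sum>us\<in>words US n. \<Sum>ss\<in>words SS n. \<Sum>zs\<in>words ZS n.
     pr1 n p us * pr2 n v us ss * pr3 n wz us ss zs *
     of_bool (pr1 n q ss * pr3 n wz us ss zs \<ge> 2 powr (n * c) * pr1 n PZ zs)) \<le> \<kappa> ^ n"
      unfolding pr[symmetric]
    proof (rule *[rule_format])
      fix us ss zs assume w: "us \<in> words US n" "ss \<in> words SS n" "zs \<in> words ZS n"
        and P: "pr3 n (\<lambda>u s z. p u * v u s * wz u s z) us ss zs > 0"
        and le: "pr1 n q ss * pr3 n wz us ss zs \<ge> 2 powr (n * c) * pr1 n PZ zs"
      have v: "pr2 n v us ss > 0"
        using P ext.p0[OF w(1)] ext.v0[OF w(1,2)] ext.wz0[OF w] by (auto simp: pr less_le)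
      have PZ: "pr1 n PZ zs > 0" by (rule ext.PZ_pos[OF w(3)])
      have "2 powr (n * c) * pr1 n PZ zs * pr2 n v us ss \<le> pr1 n q ss * (pr2 n v us ss * pr3 n wz us ss zs)"
        using mult_right_mono[OF le less_imp_le[OF v]] by (simp add: mult_ac)
      also have "\<dots> \<le> pr1 n q ss * pr2 n VZ us zs"
        by (intro mult_left_mono ext.VZ_ge ext.q0 w)
      finally show "2 powr (n * c) \<le> pr3 n r us ss zs"
        using v PZ by (simp add: pr' field_simps)
    qed
  qed
qed

end

lemma num_msgs_bounds:
  assumes "0 \<le> R"
  shows "2 powr (real n * R) \<le> real (num_msgs n R)" "real (num_msgs n R) \<le> 2 * 2 powr (real n * R)"
proof -
  let ?t = "2 powr (real n * R)"
  \<comment> \<open>Rounding up adds less than 1, and this is at most \<open>?t\<close> because the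
    rate is nonnegative; hence the factor 2.\<close>
  have t: "1 \<le> ?t" using assms by (intro ge_one_powr_ge_zero) auto
  have "real (num_msgs n R) = of_int \<lceil>?t\<rceil>" by (simp add: num_msgs_def)
  then show "?t \<le> real (num_msgs n R)" "real (num_msgs n R) \<le> 2 * ?t"
    using t by linarith+
qed

text \<open>One hypothesis per error term. The decoder threshold
  \<open>2 powr (n * (R + R' + \<gamma>))\<close> exceeds the codebook size and stays below the
  density of the true pair; the truncation level is \<open>2 powr (- n * \<gamma>)\<close>, so the
  three covering conditions ask that the respective rate beat its information by more than
  \<open>\<gamma>\<close>.\<close>

lemma (in channel_model) exponentially_good_codes:
  assumes "0 \<le> R" "0 \<le> R'" "0 < \<gamma>"
    and Y: "R + R' + \<gamma> < IY" and S: "IS < R' - \<gamma>" and Z: "IZ < R + R' - \<gamma>"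
    and B: "IZ - IS < R - \<gamma>"
  shows "\<exists>\<kappa>. 0 \<le> \<kappa> \<and> \<kappa> < 1 \<and> (\<forall>n. \<exists>e d. (\<forall>m\<in>{1..num_msgs n R}. \<forall>ss\<in>words SS n. e m ss \<in> words US n) \<and>
     (\<Sum>m\<in>{1..num_msgs n R}. \<Sum>ss\<in>words SS n. \<Sum>ys\<in>words YS n.
        1 / num_msgs n R * (pr1 n q ss * pr3 n wy (e m ss) ss ys * of_bool (d ys \<noteq> m)))
     + (\<Sum>zs\<in>words ZS n. \<bar>(\<Sum>m\<in>{1..num_msgs n R}. \<Sum>ss\<in>words SS n.
        1 / num_msgs n R * (pr1 n q ss * pr3 n wz (e m ss) ss zs)) - pr1 n PZ zs\<bar>) \<le> 23 * \<kappa> ^ n)"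
proof -
  obtain \<kappa>Y where \<kappa>Y: "0 \<le> \<kappa>Y" "\<kappa>Y < 1" "\<And>n. (\<Sum>us\<in>words US n. \<Sum>ys\<in>words YS n.
     pr1 n p us * pr2 n VY us ys * of_bool (pr2 n VY us ys \<le> 2 powr (n * (R + R' + \<gamma>)) * pr1 n PY ys)) \<le> \<kappa>Y ^ n"
    using tail_Y[OF Y] by auto
  obtain \<kappa>S where \<kappa>S: "0 \<le> \<kappa>S" "\<kappa>S < 1" "\<And>n. (\<Sum>us\<in>words US n. \<Sum>ss\<in>words SS n.
     pr1 n p us * pr2 n v us ss * of_bool (pr2 n v us ss \<ge> 2 powr (n * (R' - \<gamma>)) * pr1 n q ss)) \<le> \<kappa>S ^ n"
    using tail_S[OF S] by auto
  obtain \<kappa>Z where \<kappa>Z: "0 \<le> \<kappa>Z" "\<kappa>Z < 1" "\<And>n. (\<Sum>us\<in>words US n. \<Sum>zs\<in>words ZS n.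
     pr1 n p us * pr2 n VZ us zs * of_bool (pr2 n VZ us zs \<ge> 2 powr (n * (R + R' - \<gamma>)) * pr1 n PZ zs)) \<le> \<kappa>Z ^ n"
    using tail_Z[OF Z] by auto
  obtain \<kappa>B where \<kappa>B: "0 \<le> \<kappa>B" "\<kappa>B < 1" "\<And>n. (\<Sum>us\<in>words US n. \<Sum>ss\<in>words SS n. \<Sum>zs\<in>words ZS n.
     pr1 n p us * pr2 n v us ss * pr3 n wz us ss zs *
     of_bool (pr1 n q ss * pr3 n wz us ss zs \<ge> 2 powr (n * (R - \<gamma>)) * pr1 n PZ zs)) \<le> \<kappa>B ^ n"
    using tail_B[OF B] by auto
  \<comment> \<open>The last entry has exponent \<open>\<gamma> / 2\<close> because the truncation
    level enters the one-shot bound through its square root.\<close>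
  define \<kappa> where "\<kappa> = Max {\<kappa>Y, \<kappa>S, \<kappa>Z, \<kappa>B, 2 powr - (\<gamma> / 2)}"
  have g: "2 powr - \<gamma> \<le> 2 powr - (\<gamma> / 2)" "2 powr - (\<gamma> / 2) < (1::real)"
    using \<open>0 < \<gamma>\<close> by (auto simp: powr_less_one)
  have \<kappa>_ge: "\<kappa>Y \<le> \<kappa>" "\<kappa>S \<le> \<kappa>" "\<kappa>Z \<le> \<kappa>" "\<kappa>B \<le> \<kappa>" "2 powr - (\<gamma> / 2) \<le> \<kappa>" "2 powr - \<gamma> \<le> \<kappa>"
    using g unfolding \<kappa>_def by (auto simp: le_max_iff_disj)
  have \<kappa>1: "\<kappa> < 1" using g \<kappa>Y \<kappa>S \<kappa>Z \<kappa>B unfolding \<kappa>_def by simp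
  have \<kappa>0: "0 \<le> \<kappa>" using \<kappa>_ge \<kappa>Y by linarith
  show ?thesis
  proof (intro exI[of _ \<kappa>] conjI \<kappa>0 \<kappa>1 allI)
    fix n :: nat
    define M where "M = real (num_msgs n R)"
    define J where "J = real (num_msgs n R')"
    define t where "t = 2 powr (n * (R + R' + \<gamma>))"
    define h where "h = 2 powr (n * - \<gamma>)"
    have Mb: "2 powr (n * R) \<le> M" "M \<le> 2 * 2 powr (n * R)"
      unfolding M_def using num_msgs_bounds[OF \<open>0 \<le> R\<close>] by auto
    have Jb: "2 powr (n * R') \<le> J" "J \<le> 2 * 2 powr (n * R')"
      unfolding J_def using num_msgs_bounds[OF \<open>0 \<le> R'\<close>] by auto
    have pos: "0 < M" "0 < J" "0 < t" "0 < h"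
      using Mb(1) Jb(1) by (auto simp: t_def h_def intro: less_le_trans[rotated])
    interpret os: one_shot_coding "words US n" "words SS n" "words YS n" "words ZS n"
      "pr1 n p" "pr2 n v" "pr3 n wy" "pr3 n wz" "pr1 n q" "pr2 n VY" "pr2 n VZ" "pr1 n PY" "pr1 n PZ"
      "{1..num_msgs n R}" "{1..num_msgs n R'}" M J t h
      by (intro one_shot_coding.intro words_extension one_shot_coding_axioms.intro)
         (use pos in \<open>simp_all add: M_def J_def\<close>)
    have eY: "os.eY \<le> \<kappa>Y ^ n" unfolding os.eY_def unfolding t_def by (rule \<kappa>Y(3))
    have Jh: "2 powr (n * (R' - \<gamma>)) \<le> J * h"
    proof -
      have "2 powr (n * (R' - \<gamma>)) = 2 powr (n * R') * h"
        by (simp add: h_def algebra_simps flip: powr_add)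
      then show ?thesis using mult_right_mono[OF Jb(1), of h] pos by simp
    qed
    have Mh: "2 powr (n * (R - \<gamma>)) \<le> M * h"
    proof -
      have "2 powr (n * (R - \<gamma>)) = 2 powr (n * R) * h"
        by (simp add: h_def algebra_simps flip: powr_add)
      then show ?thesis using mult_right_mono[OF Mb(1), of h] pos by simp
    qed
    have MJh: "2 powr (n * (R + R' - \<gamma>)) \<le> M * J * h"
    proof -
      have "2 powr (n * (R + R' - \<gamma>)) = 2 powr (n * R) * (2 powr (n * (R' - \<gamma>)))"
        by (simp add: algebra_simps flip: powr_add)
      also have "\<dots> \<le> M * (J * h)" using Mb(1) Jh pos by (intro mult_mono) auto
      finally show ?thesis by (simp add: mult.assoc)
    qed
    \<comment> \<open>The one-shot thresholds contain the rounded sizes \<open>M\<close> and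
      \<open>J\<close>; by \<open>Mh\<close>, \<open>Jh\<close> and \<open>MJh\<close> they are at
      least the exact powers in the tail bounds.\<close>
    have mono: "of_bool (a > k * b) \<le> (of_bool (a \<ge> l * b) :: real)" if "l \<le> k" "0 \<le> b" for a b k l :: real
      using mult_right_mono[OF that] by auto
    have eS: "os.eS \<le> \<kappa>S ^ n"
      unfolding os.eS_def
      by (rule order.trans[OF _ \<kappa>S(3)]) (intro sum_mono mult_left_mono mono Jh os.q0 mult_nonneg_nonneg os.p0 os.v0)
    have eZ: "os.eZ \<le> \<kappa>Z ^ n"
      unfolding os.eZ_def
      by (rule order.trans[OF _ \<kappa>Z(3)])
         (intro sum_mono mult_left_mono mono MJh less_imp_le[OF os.PZ_pos] mult_nonneg_nonneg os.p0 os.VZ0)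
    have eB: "os.eB \<le> \<kappa>B ^ n"
      unfolding os.eB_def
      by (rule order.trans[OF _ \<kappa>B(3)])
         (intro sum_mono mult_left_mono mono Mh less_imp_le[OF os.PZ_pos] mult_nonneg_nonneg os.p0 os.v0 os.wz0)
    \<comment> \<open>The 4 comes from rounding up the two sizes, a factor 2 each. In the total
      below, 23 is \<open>1 + 4 + 8 + 2 + 2 + 6\<close>.\<close>
    have MJt: "M * J / t \<le> 4 * (2 powr - \<gamma>) ^ n"
    proof -
      have "M * J \<le> (2 * 2 powr (n * R)) * (2 * 2 powr (n * R'))"
        using Mb(2) Jb(2) pos by (intro mult_mono) auto
      also have "\<dots> = 4 * (2 powr - \<gamma>) ^ n * t"
        by (simp add: t_def algebra_simps powr_powr flip: powr_add powr_realpow)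
      finally show ?thesis using pos by (simp add: divide_le_eq)
    qed
    have sqh: "sqrt h = (2 powr - (\<gamma> / 2)) ^ n"
      by (simp add: h_def powr_half_sqrt[symmetric] powr_powr mult.commute flip: powr_realpow)
    have pw: "x ^ n \<le> \<kappa> ^ n" if "0 \<le> x" "x \<le> \<kappa>" for x using that by (intro power_mono)
    have "os.eY + M * J / t + 8 * os.eS + 2 * os.eZ + 2 * os.eB + 6 * sqrt h
       \<le> \<kappa> ^ n + 4 * \<kappa> ^ n + 8 * \<kappa> ^ n + 2 * \<kappa> ^ n + 2 * \<kappa> ^ n + 6 * \<kappa> ^ n"
      unfolding sqh
      by (intro add_mono mult_left_mono order.trans[OF eY] order.trans[OF eS] order.trans[OF eZ]
           order.trans[OF eB] order.trans[OF MJt] pw \<kappa>_ge \<kappa>Y \<kappa>S \<kappa>Z \<kappa>B) auto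
    also have "\<dots> = 23 * \<kappa> ^ n" by simp
    finally have le: "os.eY + M * J / t + 8 * os.eS + 2 * os.eZ + 2 * os.eB + 6 * sqrt h \<le> 23 * \<kappa> ^ n" .
    from os.one_shot_code obtain e d where "\<forall>m\<in>{1..num_msgs n R}. \<forall>ss\<in>words SS n. e m ss \<in> words US n"
      "(\<Sum>m\<in>{1..num_msgs n R}. \<Sum>ss\<in>words SS n. \<Sum>ys\<in>words YS n.
        1 / M * (pr1 n q ss * pr3 n wy (e m ss) ss ys * of_bool (d ys \<noteq> m)))
     + (\<Sum>zs\<in>words ZS n. \<bar>(\<Sum>m\<in>{1..num_msgs n R}. \<Sum>ss\<in>words SS n.
        1 / M * (pr1 n q ss * pr3 n wz (e m ss) ss zs)) - pr1 n PZ zs\<bar>)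
     \<le> os.eY + M * J / t + 8 * os.eS + 2 * os.eZ + 2 * os.eB + 6 * sqrt h"
      by (elim exE conjE) (rule that)
    then show "\<exists>e d. (\<forall>m\<in>{1..num_msgs n R}. \<forall>ss\<in>words SS n. e m ss \<in> words US n) \<and>
     (\<Sum>m\<in>{1..num_msgs n R}. \<Sum>ss\<in>words SS n. \<Sum>ys\<in>words YS n.
        1 / num_msgs n R * (pr1 n q ss * pr3 n wy (e m ss) ss ys * of_bool (d ys \<noteq> m)))
     + (\<Sum>zs\<in>words ZS n. \<bar>(\<Sum>m\<in>{1..num_msgs n R}. \<Sum>ss\<in>words SS n.
        1 / num_msgs n R * (pr1 n q ss * pr3 n wz (e m ss) ss zs)) - pr1 n PZ zs\<bar>) \<le> 23 * \<kappa> ^ n"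
      using le unfolding M_def[symmetric] by (intro exI[of _ e] exI[of _ d] conjI) (assumption, rule order.trans)
  qed
qed

section \<open>Relative entropy and mutual information\<close>

text \<open>A reverse Pinsker inequality: since \<open>P zs \<le> 1\<close> and
  \<open>Q zs \<ge> \<mu> ^ n\<close>, the log ratio is at most \<open>n * ln (1 / \<mu>)\<close>,
  and only words with \<open>P zs > Q zs\<close> contribute positively. The lower bound is Gibbs'
  inequality.\<close>

lemma KL_seq_bounds:
  fixes P Q :: "'z::finite list \<Rightarrow> real"
  assumes P0: "\<And>zs. zs \<in> seqs n \<Longrightarrow> 0 \<le> P zs" and P1: "(\<Sum>zs\<in>seqs n. P zs) = 1"
    and Q1: "(\<Sum>zs\<in>seqs n. Q zs) = 1"
    and \<mu>: "0 < \<mu>" "\<mu> \<le> 1" and Q: "\<And>zs. zs \<in> seqs n \<Longrightarrow> \<mu> ^ n \<le> Q zs"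
  shows "0 \<le> KL_seq n P Q"
    and "KL_seq n P Q \<le> (1 + n * ln (1 / \<mu>)) / ln 2 * (\<Sum>zs\<in>seqs n. \<bar>P zs - Q zs\<bar>)"
proof -
  have fin: "finite (seqs n :: 'z list set)" unfolding seqs_eq_words by (simp add: finite_words)
  have Qpos: "0 < Q zs" if "zs \<in> seqs n" for zs
    using Q[OF that] \<mu> by (meson less_le_trans zero_less_power)
  have Ple: "P zs \<le> 1" if "zs \<in> seqs n" for zs
    unfolding P1[symmetric] using that P0 fin by (intro member_le_sum) auto
  have low: "(P zs - Q zs) / ln 2 \<le> (if P zs = 0 then 0 else P zs * log 2 (P zs / Q zs))"
    if zs: "zs \<in> seqs n" for zs
  proof (cases "P zs = 0")
    case True then show ?thesis using Qpos[OF zs] by simp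
  next
    case False
    then have p: "P zs > 0" using P0[OF zs] by simp
    have "1 - Q zs / P zs \<le> ln (P zs / Q zs)"
      using ln_le_minus_one[of "Q zs / P zs"] p Qpos[OF zs] by (simp add: ln_div)
    then have "P zs * (1 - Q zs / P zs) \<le> P zs * ln (P zs / Q zs)" using p by (intro mult_left_mono) auto
    moreover have "P zs * (1 - Q zs / P zs) = P zs - Q zs" using p by (simp add: field_simps)
    ultimately show ?thesis using False by (simp add: log_def divide_right_mono)
  qed
  have "0 = (\<Sum>zs\<in>seqs n. (P zs - Q zs) / ln 2)"
    by (simp add: sum_subtractf P1 Q1 flip: sum_divide_distrib)
  also have "\<dots> \<le> KL_seq n P Q" unfolding KL_seq_def by (intro sum_mono low)
  finally show "0 \<le> KL_seq n P Q" .
  have l: "0 \<le> ln (1 / \<mu>)" using \<mu> by simp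
  have up: "(if P zs = 0 then 0 else P zs * log 2 (P zs / Q zs))
      \<le> (1 + n * ln (1 / \<mu>)) / ln 2 * \<bar>P zs - Q zs\<bar>" if zs: "zs \<in> seqs n" for zs
  proof -
    have rhs: "0 \<le> (1 + n * ln (1 / \<mu>)) / ln 2 * \<bar>P zs - Q zs\<bar>" using l by simp
    consider "P zs = 0" | "0 < P zs" "P zs \<le> Q zs" | "Q zs < P zs" using P0[OF zs] by linarith
    then show ?thesis
    proof cases
      case 1 then show ?thesis using rhs by simp
    next
      case 2
      then have "P zs * log 2 (P zs / Q zs) \<le> 0"
        using Qpos[OF zs] by (intro mult_nonneg_nonpos) auto
      then show ?thesis using rhs 2 by simp
    next
      case 3
      \<comment> \<open>Write \<open>P\<close> as \<open>(P - Q) + Q\<close>: on the first part the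
        log ratio is bounded by its maximum, on the second \<open>ln x \<le> x - 1\<close> again
        yields \<open>P - Q\<close>.\<close>
      have q: "0 < Q zs" by (rule Qpos[OF zs])
      have "ln (P zs / Q zs) \<le> ln (1 / \<mu> ^ n)"
        using 3 q Ple[OF zs] Q[OF zs] \<mu> by (intro ln_mono frac_le) auto
      also have "\<dots> = n * ln (1 / \<mu>)" using \<mu> by (simp add: ln_div ln_realpow)
      finally have a: "(P zs - Q zs) * ln (P zs / Q zs) \<le> (P zs - Q zs) * (n * ln (1 / \<mu>))"
        using 3 by (intro mult_left_mono) auto
      have "Q zs * ln (P zs / Q zs) \<le> Q zs * (P zs / Q zs - 1)"
        using 3 q by (intro mult_left_mono ln_le_minus_one) auto
      also have "\<dots> = P zs - Q zs" using q by (simp add: field_simps)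
      finally have "P zs * ln (P zs / Q zs) \<le> (P zs - Q zs) * (1 + n * ln (1 / \<mu>))"
        using a by (simp add: algebra_simps)
      then have "P zs * ln (P zs / Q zs) / ln 2 \<le> (P zs - Q zs) * (1 + n * ln (1 / \<mu>)) / ln 2"
        by (intro divide_right_mono) auto
      then show ?thesis using 3 q by (simp add: log_def mult.commute)
    qed
  qed
  show "KL_seq n P Q \<le> (1 + n * ln (1 / \<mu>)) / ln 2 * (\<Sum>zs\<in>seqs n. \<bar>P zs - Q zs\<bar>)"
    unfolding KL_seq_def sum_distrib_left by (intro sum_mono up)
qed

section \<open>From pmfs to finite sums\<close>

lemma pmf_bind_finite:
  assumes "finite K" "set_pmf r \<subseteq> K"
  shows "pmf (bind_pmf r g) b = (\<Sum>x\<in>K. pmf r x * pmf (g x) b)"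
  unfolding pmf_bind using assms by (subst integral_measure_pmf_real[of K]) (auto simp: mult.commute)

lemma pmf_map_finite:
  assumes "finite K" "set_pmf r \<subseteq> K"
  shows "pmf (map_pmf g r) b = (\<Sum>x\<in>K. pmf r x * of_bool (g x = b))"
  unfolding map_pmf_def pmf_bind_finite[OF assms]
  by (intro sum.cong) (auto simp: pmf_return)

text \<open>On \<open>A\<close> the factor \<open>p u\<close> is positive and cancels inside the
  logarithm, leaving the kernel against its output law. Pairs of weight zero may be added to the sum
  freely.\<close>

lemma mutual_info_kernel:
  fixes r :: "('u \<times> 'b::finite) pmf"
  assumes A: "finite A" and p: "\<And>u. u \<in> A \<Longrightarrow> 0 < p u"
    and V1: "\<And>u. u \<in> A \<Longrightarrow> (\<Sum>b\<in>UNIV. V u b) = 1"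
    and r: "\<And>u b. u \<in> A \<Longrightarrow> pmf r (u, b) = p u * V u b"
    and supp: "set_pmf r \<subseteq> A \<times> UNIV"
    and PB: "\<And>b. PB b = (\<Sum>u\<in>A. p u * V u b)"
  shows "mutual_info r = (\<Sum>u\<in>A. \<Sum>b\<in>UNIV. p u * V u b * log 2 (V u b / PB b))"
proof -
  have fin: "finite (A \<times> (UNIV :: 'b set))" using A by simp
  have m1: "pmf (map_pmf fst r) u = p u" if u: "u \<in> A" for u
  proof -
    have "pmf (map_pmf fst r) u = (\<Sum>w\<in>A. if w = u then (\<Sum>b\<in>UNIV. pmf r (w, b)) else 0)"
      unfolding pmf_map_finite[OF fin supp] sum.cartesian_product'
      by (intro sum.cong) auto
    also have "\<dots> = (\<Sum>b\<in>UNIV. p u * V u b)" using u A by (simp add: r)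
    finally show ?thesis using u by (simp add: V1 flip: sum_distrib_left)
  qed
  have m2: "pmf (map_pmf snd r) b = PB b" for b
  proof -
    have "pmf (map_pmf snd r) b = (\<Sum>w\<in>A. \<Sum>b'\<in>UNIV. if b' = b then pmf r (w, b') else 0)"
      unfolding pmf_map_finite[OF fin supp] sum.cartesian_product'
      by (intro sum.cong) auto
    also have "\<dots> = PB b" unfolding PB by (intro sum.cong) (auto simp: r)
    finally show ?thesis .
  qed
  have "mutual_info r = (\<Sum>ab\<in>A \<times> UNIV.
      pmf r ab * log 2 (pmf r ab / (pmf (map_pmf fst r) (fst ab) * pmf (map_pmf snd r) (snd ab))))"
    unfolding mutual_info_def using supp fin
    by (intro sum.mono_neutral_left) (auto simp: set_pmf_iff)
  also have "\<dots> = (\<Sum>u\<in>A. \<Sum>b\<in>UNIV. p u * V u b * log 2 (V u b / PB b))"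
    unfolding sum.cartesian_product'
    by (intro sum.cong refl) (use p in \<open>force simp: r m1 m2\<close>)
  finally show ?thesis .
qed

text \<open>One formula for the laws of \<open>(U,Y)\<close>, \<open>(U,Z)\<close> and
  \<open>(U,S)\<close>: \<open>f s\<close> is \<open>fst\<close>, \<open>snd\<close> or the constant
  \<open>s\<close>, which is why \<open>f\<close> takes the state as an argument.\<close>

lemma pmf_joint:
  fixes QS :: "'s::finite pmf"
  assumes fin: "finite K" and supp: "\<And>s. set_pmf (PU s) \<subseteq> K"
  shows "pmf (map_pmf (\<lambda>(s, u, x, y, z). (u, f s (y, z))) (joint_SUXYZ QS W PU xf)) (u, b)
    = (\<Sum>s\<in>UNIV. pmf QS s * pmf (PU s) u * pmf (map_pmf (f s) (W (xf u s) s)) b)"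
proof -
  have eq: "map_pmf (\<lambda>(s, u, x, y, z). (u, f s (y, z))) (joint_SUXYZ QS W PU xf)
     = bind_pmf QS (\<lambda>s. bind_pmf (PU s) (\<lambda>u. map_pmf (Pair u) (map_pmf (f s) (W (xf u s) s))))"
    by (simp add: joint_SUXYZ_def map_bind_pmf map_pmf_comp o_def map_pmf_def[symmetric] bind_return_pmf' flip: bind_map_pmf)
  have inner: "pmf (bind_pmf (PU s) (\<lambda>w. map_pmf (Pair w) (map_pmf (f s) (W (xf w s) s)))) (u, b)
     = pmf (PU s) u * pmf (map_pmf (f s) (W (xf u s) s)) b" for s
  proof -
    have pr: "pmf (map_pmf (Pair w) t) (u, b) = (if w = u then pmf t b else 0)" for w t
    proof (cases "w = u")
      case True
      then show ?thesis using pmf_map_inj'[of "Pair u" t b] by (simp add: inj_def)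
    qed (auto simp: pmf_eq_0_set_pmf)
    \<comment> \<open>Summing over \<open>insert u K\<close> treats \<open>u\<close> inside and
      outside the auxiliary alphabet alike.\<close>
    have "pmf (bind_pmf (PU s) (\<lambda>w. map_pmf (Pair w) (map_pmf (f s) (W (xf w s) s)))) (u, b)
       = (\<Sum>w\<in>insert u K. pmf (PU s) w * (if w = u then pmf (map_pmf (f s) (W (xf w s) s)) b else 0))"
      using supp[of s] fin by (subst pmf_bind_finite[of "insert u K"]) (auto simp: pr)
    also have "\<dots> = (\<Sum>w\<in>insert u K. if w = u then pmf (PU s) w * pmf (map_pmf (f s) (W (xf w s) s)) b else 0)"
      by (intro sum.cong) auto
    finally show ?thesis using fin by simp
  qed
  show ?thesis
    unfolding eq by (subst pmf_bind_finite[of UNIV]) (auto simp: inner mult.assoc)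
qed

section \<open>Achievability\<close>

lemma sum_WZ: "(\<Sum>z\<in>UNIV. WZ W x s z) = 1" for W :: "'x \<Rightarrow> 's \<Rightarrow> ('y \<times> 'z::finite) pmf"
  unfolding WZ_def by (rule sum_pmf_eq_1) auto

lemma sum_state_prob: "(\<Sum>ss\<in>seqs n. state_prob QS ss) = 1" for QS :: "'s::finite pmf"
proof -
  have "(\<Sum>ss\<in>seqs n. state_prob QS ss) = (\<Sum>ss\<in>words UNIV n. \<Prod>i<n. pmf QS (ss ! i))"
    unfolding seqs_eq_words by (intro sum.cong) (auto simp: state_prob_def words_def)
  also have "\<dots> = 1"
    using sum_words_prod[where g = "\<lambda>_. pmf QS" and A = UNIV and n = n] sum_pmf_eq_1[of UNIV QS] by simp
  finally show ?thesis .
qed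

lemma sum_chanZ: "(\<Sum>zs\<in>seqs n. chanZ W xs ss zs) = 1"
  for W :: "'x \<Rightarrow> 's \<Rightarrow> ('y \<times> 'z::finite) pmf"
proof -
  have "(\<Sum>zs\<in>seqs n. chanZ W xs ss zs) = (\<Sum>zs\<in>words UNIV n. \<Prod>i<n. WZ W (xs ! i) (ss ! i) (zs ! i))"
    unfolding seqs_eq_words by (intro sum.cong) (auto simp: chanZ_def words_def)
  also have "\<dots> = 1"
    using sum_words_prod[where g = "\<lambda>i. WZ W (xs ! i) (ss ! i)" and A = UNIV and n = n] by (simp add: sum_WZ)
  finally show ?thesis .
qed

lemma num_msgs_pos: "0 < num_msgs n R"
  by (simp add: num_msgs_def)

lemma state_prob_nonneg: "0 \<le> state_prob QS ss"
  by (auto simp: state_prob_def intro!: prod_nonneg)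

lemma warden_dist_nonneg: "0 \<le> warden_dist QS W n R enc zs"
  unfolding warden_dist_def chanZ_def WZ_def
  by (intro mult_nonneg_nonneg sum_nonneg prod_nonneg ballI state_prob_nonneg pmf_nonneg) auto

lemma error_prob_nonneg: "0 \<le> error_prob QS W n R enc d"
  unfolding error_prob_def chanY_def WY_def
  by (intro mult_nonneg_nonneg sum_nonneg prod_nonneg ballI state_prob_nonneg pmf_nonneg) auto

lemma sum_warden_dist: "(\<Sum>zs\<in>seqs n. warden_dist QS W n R enc zs) = 1"
  for QS :: "'s::finite pmf" and W :: "'x \<Rightarrow> 's \<Rightarrow> ('y \<times> 'z::finite) pmf"
proof -
  have "(\<Sum>zs\<in>seqs n. warden_dist QS W n R enc zs) = 1 / real (num_msgs n R) *
     (\<Sum>m\<in>{1..num_msgs n R}. \<Sum>ss\<in>seqs n. \<Sum>zs\<in>seqs n. state_prob QS ss * chanZ W (enc m ss) ss zs)"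
    unfolding warden_dist_def
    by (subst sum_distrib_left[symmetric], subst sum.swap,
        intro arg_cong2[of _ _ _ _ "(*)"] refl sum.cong, rule sum.swap)
  also have "\<dots> = 1"
    using num_msgs_pos[of n R] by (simp add: sum_chanZ sum_state_prob flip: sum_distrib_left)
  finally show ?thesis .
qed

lemma sum_Q0: "(\<Sum>z\<in>UNIV. Q0 QS W x0 z) = 1"
  for QS :: "'s::finite pmf" and W :: "'x \<Rightarrow> 's \<Rightarrow> ('y \<times> 'z::finite) pmf"
  unfolding Q0_def by (subst sum.swap) (simp add: sum_WZ sum_pmf_eq_1 flip: sum_distrib_left)

lemma Q0n_eq: "zs \<in> seqs n \<Longrightarrow> Q0n QS W x0 zs = pr1 n (Q0 QS W x0) zs"
  by (auto simp: Q0n_def pr1_def seqs_def)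

lemma sum_Q0n: "(\<Sum>zs\<in>seqs n. Q0n QS W x0 zs) = 1"
  for QS :: "'s::finite pmf" and W :: "'x \<Rightarrow> 's \<Rightarrow> ('y \<times> 'z::finite) pmf"
proof -
  have "(\<Sum>zs\<in>seqs n. Q0n QS W x0 zs) = (\<Sum>zs\<in>words UNIV n. \<Prod>i<n. Q0 QS W x0 (zs ! i))"
    unfolding seqs_eq_words by (intro sum.cong) (auto simp: Q0n_def words_def)
  also have "\<dots> = 1"
    using sum_words_prod[where g = "\<lambda>_. Q0 QS W x0" and A = UNIV and n = n] by (simp add: sum_Q0)
  finally show ?thesis .
qed

lemma KL_seq_warden_tendsto_0:
  fixes QS :: "'s::finite pmf" and W :: "'x \<Rightarrow> 's \<Rightarrow> ('y::finite \<times> 'z::finite) pmf"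
  assumes Q0: "\<forall>z. Q0 QS W x0 z > 0" and \<kappa>: "0 \<le> \<kappa>" "\<kappa> < 1"
    and dist: "\<And>n. (\<Sum>zs\<in>seqs n. \<bar>warden_dist QS W n R (enc n) zs - Q0n QS W x0 zs\<bar>) \<le> C * \<kappa> ^ n"
  shows "(\<lambda>n. KL_seq n (warden_dist QS W n R (enc n)) (Q0n QS W x0)) \<longlonglongrightarrow> 0"
proof -
  define \<mu> where "\<mu> = Min (range (Q0 QS W x0))"
  have \<mu>_le: "\<mu> \<le> Q0 QS W x0 z" for z by (simp add: \<mu>_def)
  have \<mu>0: "0 < \<mu>" using Q0 by (simp add: \<mu>_def)
  have \<mu>1: "\<mu> \<le> 1"
  proof -
    have "Q0 QS W x0 z \<le> (\<Sum>z\<in>UNIV. Q0 QS W x0 z)" for z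
      using Q0 by (intro member_le_sum) (auto simp: less_imp_le)
    then show ?thesis using \<mu>_le order.trans by (metis sum_Q0)
  qed
  have Qn: "\<mu> ^ n \<le> Q0n QS W x0 zs" if "zs \<in> seqs n" for n zs
  proof -
    have "\<mu> ^ n = (\<Prod>i<n. \<mu>)" by simp
    also have "\<dots> \<le> (\<Prod>i<n. Q0 QS W x0 (zs ! i))"
      using \<mu>0 \<mu>_le by (intro prod_mono) auto
    finally show ?thesis using that by (simp add: Q0n_def seqs_def)
  qed
  \<comment> \<open>The linear factor from \<open>KL_seq_bounds\<close> meets the geometric decay:
    \<open>n * \<kappa> ^ n\<close> still tends to 0.\<close>
  define b where "b n = C / ln 2 * \<kappa> ^ n + C * ln (1 / \<mu>) / ln 2 * (n * \<kappa> ^ n)" for n :: nat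
  have "b \<longlonglongrightarrow> C / ln 2 * 0 + C * ln (1 / \<mu>) / ln 2 * 0"
    unfolding b_def using \<kappa>
    by (intro tendsto_intros LIMSEQ_power_zero powser_times_n_limit_0) auto
  then have b: "b \<longlonglongrightarrow> 0" by simp
  show ?thesis
  proof (rule tendsto_sandwich[OF _ _ tendsto_const b])
    note KL = KL_seq_bounds[where \<mu> = \<mu>, OF warden_dist_nonneg sum_warden_dist sum_Q0n \<mu>0 \<mu>1 Qn]
    show "\<forall>\<^sub>F n in sequentially. 0 \<le> KL_seq n (warden_dist QS W n R (enc n)) (Q0n QS W x0)"
      by (intro always_eventually allI KL(1))
    show "\<forall>\<^sub>F n in sequentially. KL_seq n (warden_dist QS W n R (enc n)) (Q0n QS W x0) \<le> b n"
    proof (intro always_eventually allI)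
      fix n
      have "KL_seq n (warden_dist QS W n R (enc n)) (Q0n QS W x0)
         \<le> (1 + n * ln (1 / \<mu>)) / ln 2 * (\<Sum>zs\<in>seqs n. \<bar>warden_dist QS W n R (enc n) zs - Q0n QS W x0 zs\<bar>)"
        by (rule KL(2))
      also have "\<dots> \<le> (1 + n * ln (1 / \<mu>)) / ln 2 * (C * \<kappa> ^ n)"
        using \<mu>0 \<mu>1 by (intro mult_left_mono dist divide_nonneg_nonneg add_nonneg_nonneg mult_nonneg_nonneg) auto
      also have "\<dots> = b n" by (simp add: b_def field_simps)
      finally show "KL_seq n (warden_dist QS W n R (enc n)) (Q0n QS W x0) \<le> b n" .
    qed
  qed
qed

text \<open>At rate 0 there is a single message; sending \<open>x0\<close> throughout gives the
  warden exactly the product law, and guessing message 1 is never wrong.\<close>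

lemma achievable_0:
  fixes QS :: "'s::finite pmf" and W :: "'x \<Rightarrow> 's \<Rightarrow> ('y::finite \<times> 'z::finite) pmf"
  assumes Q0: "\<forall>z. Q0 QS W x0 z > 0"
  shows "achievable QS W x0 0"
proof -
  define enc where "enc n m ss = replicate n x0" for n m :: nat and ss :: "'s list"
  have M: "num_msgs n 0 = 1" for n by (simp add: num_msgs_def)
  have w: "warden_dist QS W n 0 (enc n) zs = Q0n QS W x0 zs" if zs: "zs \<in> seqs n" for n zs
  proof -
    have "warden_dist QS W n 0 (enc n) zs
        = (\<Sum>ss\<in>words UNIV n. \<Prod>i<n. pmf QS (ss ! i) * WZ W x0 (ss ! i) (zs ! i))"
      using zs unfolding warden_dist_def M seqs_eq_words
      by (auto simp: state_prob_def chanZ_def enc_def words_def prod.distrib intro!: sum.cong)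
    also have "\<dots> = Q0n QS W x0 zs"
      using zs sum_words_prod[where g = "\<lambda>i s. pmf QS s * WZ W x0 s (zs ! i)" and A = UNIV and n = n]
      by (simp add: Q0n_def Q0_def seqs_def)
    finally show ?thesis .
  qed
  have "error_prob QS W n 0 (enc n) (\<lambda>_. 1) = 0" for n
    by (simp add: error_prob_def M)
  moreover have "(\<lambda>n. KL_seq n (warden_dist QS W n 0 (enc n)) (Q0n QS W x0)) \<longlonglongrightarrow> 0"
    by (rule KL_seq_warden_tendsto_0[OF Q0, of 0 _ _ 0]) (simp_all add: w)
  moreover have "valid_code n 0 (enc n)" for n by (simp add: valid_code_def enc_def)
  ultimately show ?thesis
    unfolding achievable_def by (intro exI[of _ enc] exI[of _ "\<lambda>_ _. 1"]) simp
qed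

text \<open>Reverses the factorisation \<open>Q_S P_{U|S}\<close> into \<open>P_U P_{S|U}\<close>,
  identifies the three mutual informations with \<open>IY\<close>, \<open>IZ\<close>,
  \<open>IS\<close>, and converts auxiliary codewords into channel inputs.\<close>

lemma achievable_below:
  fixes QS :: "'s::finite pmf" and W :: "'x::finite \<Rightarrow> 's \<Rightarrow> ('y::finite \<times> 'z::finite) pmf"
  assumes Q0: "\<forall>z. Q0 QS W x0 z > 0" and D: "in_D QS W x0 PU xf"
    and \<gamma>: "0 < \<gamma>" "5 * \<gamma> < I_UY QS W PU xf - I_UZ QS W PU xf"
    and R: "R = I_UY QS W PU xf - I_US QS W PU xf - 4 * \<gamma>" "0 \<le> R"
  shows "achievable QS W x0 R"
proof -
  define j where "j u s = pmf QS s * pmf (PU s) u" for u s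
  define p where "p u = (\<Sum>s\<in>UNIV. j u s)" for u
  \<comment> \<open>The support of \<open>P_U\<close>: only there is the conditional law
    \<open>v\<close> a genuine division.\<close>
  define A where "A = {u. 0 < p u}"
  define v where "v u s = j u s / p u" for u s
  define wy where "wy u s y = WY W (xf u s) s y" for u s y
  define wz where "wz u s z = WZ W (xf u s) s z" for u s z
  define VY where "VY u y = (\<Sum>s\<in>UNIV. v u s * wy u s y)" for u y
  define VZ where "VZ u z = (\<Sum>s\<in>UNIV. v u s * wz u s z)" for u z
  define PY where "PY y = (\<Sum>u\<in>A. p u * VY u y)" for y
  let ?K = "{..<CARD('x) + 2}"
  have supp: "set_pmf (PU s) \<subseteq> ?K" for s using D by (simp add: in_D_def)
  have j0: "0 \<le> j u s" for u s by (simp add: j_def)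
  have pj: "j u s = 0" if "u \<notin> A" for u s
  proof -
    have "j u s \<le> p u" unfolding p_def by (rule member_le_sum) (auto simp: j0)
    then show ?thesis using that j0[of u s] by (auto simp: A_def)
  qed
  have AK: "A \<subseteq> ?K"
  proof
    fix u assume u: "u \<in> A"
    show "u \<in> ?K"
    proof (rule ccontr)
      assume "u \<notin> ?K"
      then have "pmf (PU s) u = 0" for s using supp[of s] by (auto simp: pmf_eq_0_set_pmf)
      then show False using u by (simp add: A_def p_def j_def)
    qed
  qed
  then have finA: "finite A" by (rule finite_subset) simp
  have pv: "p u * v u s = j u s" if "u \<in> A" for u s using that by (simp add: v_def A_def)
  have pVY: "p u * VY u y = (\<Sum>s\<in>UNIV. j u s * wy u s y)" if "u \<in> A" for u y
    unfolding VY_def sum_distrib_left by (intro sum.cong) (auto simp: pv[OF that] simp flip: mult.assoc)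
  have pVZ: "p u * VZ u z = (\<Sum>s\<in>UNIV. j u s * wz u s z)" if "u \<in> A" for u z
    unfolding VZ_def sum_distrib_left by (intro sum.cong) (auto simp: pv[OF that] simp flip: mult.assoc)
  have q_eq: "pmf QS s = (\<Sum>u\<in>A. p u * v u s)" for s
  proof -
    have "(\<Sum>u\<in>A. p u * v u s) = (\<Sum>u\<in>A. j u s)" by (simp add: pv)
    also have "\<dots> = (\<Sum>u\<in>?K. j u s)" using AK pj by (intro sum.mono_neutral_left) auto
    also have "\<dots> = pmf QS s" using sum_pmf_eq_1[OF _ supp, of s] by (simp add: j_def flip: sum_distrib_left)
    finally show ?thesis ..
  qed
  have v1: "(\<Sum>s\<in>UNIV. v u s) = 1" if "u \<in> A" for u
    using that by (simp add: v_def A_def flip: sum_divide_distrib p_def)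
  have p1: "(\<Sum>u\<in>A. p u) = 1"
  proof -
    have "1 = (\<Sum>s\<in>UNIV. pmf QS s)" by (simp add: sum_pmf_eq_1)
    also have "\<dots> = (\<Sum>u\<in>A. \<Sum>s\<in>UNIV. p u * v u s)" unfolding q_eq by (rule sum.swap)
    also have "\<dots> = (\<Sum>u\<in>A. p u)" by (simp add: v1 flip: sum_distrib_left)
    finally show ?thesis ..
  qed
  define J where "J = joint_SUXYZ QS W PU xf"
  have finK: "finite ?K" by simp
  have rY: "pmf (map_pmf (\<lambda>(s, u, x, y, z). (u, y)) J) (u, b) = (\<Sum>s\<in>UNIV. j u s * wy u s b)" for u b
    using pmf_joint[OF finK supp, where f = "\<lambda>_. fst" and QS = QS and W = W and xf = xf and u = u and b = b] by (simp add: J_def j_def wy_def WY_def)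
  have rZ: "pmf (map_pmf (\<lambda>(s, u, x, y, z). (u, z)) J) (u, b) = (\<Sum>s\<in>UNIV. j u s * wz u s b)" for u b
    using pmf_joint[OF finK supp, where f = "\<lambda>_. snd" and QS = QS and W = W and xf = xf and u = u and b = b] by (simp add: J_def j_def wz_def WZ_def)
  have rS: "pmf (map_pmf (\<lambda>(s, u, x, y, z). (u, s)) J) (u, b) = j u b" for u b
  proof -
    have "pmf (map_pmf (\<lambda>(s, u, x, y, z). (u, s)) J) (u, b) = (\<Sum>s\<in>UNIV. if s = b then j u s else 0)"
      using pmf_joint[OF finK supp, where f = "\<lambda>s _. s" and QS = QS and W = W and xf = xf and u = u and b = b]
      by (auto simp: J_def j_def pmf_return map_pmf_const intro!: sum.cong)
    then show ?thesis by simp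
  qed
  have supp_A: "set_pmf r \<subseteq> A \<times> UNIV" if "\<And>u b. u \<notin> A \<Longrightarrow> pmf r (u, b) = 0" for r :: "(nat \<times> 'b) pmf"
  proof (rule subsetI)
    fix w assume "w \<in> set_pmf r"
    then show "w \<in> A \<times> UNIV" using that by (cases w) (metis SigmaI UNIV_I set_pmf_iff)
  qed
  \<comment> \<open>The constraint \<open>P_Z = Q_0\<close> of \<open>in_D\<close> enters here and
    makes \<open>Q0\<close> the law that the codebook covers.\<close>
  have PZ_eq: "Q0 QS W x0 z = (\<Sum>u\<in>A. p u * VZ u z)" for z
  proof -
    have sub: "set_pmf (map_pmf (\<lambda>(s, u, x, y, z). (u, z)) J) \<subseteq> A \<times> UNIV"
      by (rule supp_A) (simp add: rZ pj)
    have "Q0 QS W x0 z = pmf (map_pmf snd (map_pmf (\<lambda>(s, u, x, y, z). (u, z)) J)) z"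
      using D by (simp add: in_D_def J_def map_pmf_comp split_def)
    also have "\<dots> = (\<Sum>w\<in>A. \<Sum>z'\<in>UNIV. if z' = z then pmf (map_pmf (\<lambda>(s, u, x, y, z). (u, z)) J) (w, z') else 0)"
      using finA by (subst pmf_map_finite[OF _ sub]) (auto simp: sum.cartesian_product' intro!: sum.cong)
    also have "\<dots> = (\<Sum>u\<in>A. p u * VZ u z)" by (simp add: rZ pVZ)
    finally show ?thesis .
  qed
  interpret channel_model A UNIV UNIV UNIV p v wy wz "pmf QS" VY VZ PY "Q0 QS W x0"
  proof
    show "0 \<le> p u" if "u \<in> A" for u using that by (simp add: A_def)
    show "0 \<le> v u s" if "u \<in> A" for u s using that j0[of u s] by (simp add: v_def A_def)
    show "Q0 QS W x0 z = (\<Sum>u\<in>A. p u * VZ u z)" for z by (rule PZ_eq)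
    show "pmf QS s = (\<Sum>u\<in>A. p u * v u s)" for s by (rule q_eq)
  qed (use finA p1 v1 Q0 in \<open>auto simp: wy_def wz_def VY_def VZ_def PY_def WY_def WZ_def sum_pmf_eq_1\<close>)
  have pA: "0 < p u" if "u \<in> A" for u using that by (simp add: A_def)
  have IY: "I_UY QS W PU xf = IY"
    unfolding I_UY_def IY_def J_def[symmetric]
    by (rule mutual_info_kernel[OF finA pA _ _ supp_A]) (simp_all add: VY1 rY pVY PY_def pj)
  have IZ: "I_UZ QS W PU xf = IZ"
    unfolding I_UZ_def IZ_def J_def[symmetric]
    by (rule mutual_info_kernel[OF finA pA _ _ supp_A]) (simp_all add: VZ1 rZ pVZ PZ_eq pj)
  have IS: "I_US QS W PU xf = IS"
    unfolding I_US_def IS_def J_def[symmetric]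
    by (rule mutual_info_kernel[OF finA pA _ _ supp_A]) (simp_all add: v1 rS pv pj, simp add: q_eq pv)
  \<comment> \<open>Index rate \<open>IS + 2 * \<gamma>\<close>, total rate
    \<open>IY - 2 * \<gamma>\<close>. The condition on the selection of indices reads
    \<open>IZ - IS < IY - IS - 5 * \<gamma>\<close>, the origin of the 5 in the hypothesis.\<close>
  have "0 \<le> IS + 2 * \<gamma>" "R + (IS + 2 * \<gamma>) + \<gamma> < IY" "IS < IS + 2 * \<gamma> - \<gamma>"
    "IZ < R + (IS + 2 * \<gamma>) - \<gamma>" "IZ - IS < R - \<gamma>"
    using \<gamma> R IS_nonneg unfolding IY IZ IS by auto
  from exponentially_good_codes[OF R(2) this(1) \<gamma>(1) this(2-)]
  obtain \<kappa> where \<kappa>: "0 \<le> \<kappa>" "\<kappa> < 1" and codes: "\<forall>n. \<exists>e d. (\<forall>m\<in>{1..num_msgs n R}. \<forall>ss\<in>words UNIV n. e m ss \<in> words A n) \<and>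
     (\<Sum>m\<in>{1..num_msgs n R}. \<Sum>ss\<in>words UNIV n. \<Sum>ys\<in>words UNIV n.
        1 / num_msgs n R * (pr1 n (pmf QS) ss * pr3 n wy (e m ss) ss ys * of_bool (d ys \<noteq> m)))
     + (\<Sum>zs\<in>words UNIV n. \<bar>(\<Sum>m\<in>{1..num_msgs n R}. \<Sum>ss\<in>words UNIV n.
        1 / num_msgs n R * (pr1 n (pmf QS) ss * pr3 n wz (e m ss) ss zs)) - pr1 n (Q0 QS W x0) zs\<bar>) \<le> 23 * \<kappa> ^ n"
    (is "\<forall>n. \<exists>e d. ?good n e d")
    by (elim exE conjE) (rule that)
  define good where "good n e d \<longleftrightarrow> ?good n e d" for n e d
  have "\<forall>n. \<exists>e d. good n e d" using codes unfolding good_def .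
  then obtain e d where ed: "\<And>n. good n (e n) (d n)" by metis
  have e: "e n m ss \<in> words A n" if "m \<in> {1..num_msgs n R}" "ss \<in> words UNIV n" for n m ss
    using ed[of n] that unfolding good_def by blast
  note bound = ed[unfolded good_def, THEN conjunct2]
  \<comment> \<open>The transmitter knows the state word, so it applies \<open>xf\<close> letter by
    letter to the selected auxiliary codeword and the state.\<close>
  define enc where "enc n m ss = map2 xf (e n m ss) ss" for n m ss
  have st: "state_prob QS ss = pr1 n (pmf QS) ss" if "ss \<in> words UNIV n" for ss n
    using that by (auto simp: state_prob_def pr1_def words_def)
  have cY: "chanY W (enc n m ss) ss ys = pr3 n wy (e n m ss) ss ys"
    if "m \<in> {1..num_msgs n R}" "ss \<in> words UNIV n" "ys \<in> words UNIV n" for n m ss ys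
    using words_length[OF e[OF that(1,2)]] words_length[OF that(2)] words_length[OF that(3)]
    by (auto simp: chanY_def pr3_def wy_def enc_def intro!: prod.cong)
  have cZ: "chanZ W (enc n m ss) ss zs = pr3 n wz (e n m ss) ss zs"
    if "m \<in> {1..num_msgs n R}" "ss \<in> words UNIV n" "zs \<in> words UNIV n" for n m ss zs
    using words_length[OF e[OF that(1,2)]] words_length[OF that(2)] words_length[OF that(3)]
    by (auto simp: chanZ_def pr3_def wz_def enc_def intro!: prod.cong)
  have err: "error_prob QS W n R (enc n) (d n) = (\<Sum>m\<in>{1..num_msgs n R}. \<Sum>ss\<in>words UNIV n. \<Sum>ys\<in>words UNIV n.
        1 / num_msgs n R * (pr1 n (pmf QS) ss * pr3 n wy (e n m ss) ss ys * of_bool (d n ys \<noteq> m)))" for n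
    unfolding error_prob_def seqs_eq_words sum_distrib_left
    by (intro sum.cong refl) (simp add: st cY)
  have war: "warden_dist QS W n R (enc n) zs = (\<Sum>m\<in>{1..num_msgs n R}. \<Sum>ss\<in>words UNIV n.
        1 / num_msgs n R * (pr1 n (pmf QS) ss * pr3 n wz (e n m ss) ss zs))" if "zs \<in> words UNIV n" for n zs
    unfolding warden_dist_def seqs_eq_words sum_distrib_left
    by (intro sum.cong refl) (simp add: st cZ that)
  define L1 where "L1 n = (\<Sum>zs\<in>seqs n. \<bar>warden_dist QS W n R (enc n) zs - Q0n QS W x0 zs\<bar>)" for n
  have L1: "L1 n = (\<Sum>zs\<in>words UNIV n. \<bar>(\<Sum>m\<in>{1..num_msgs n R}. \<Sum>ss\<in>words UNIV n.
        1 / num_msgs n R * (pr1 n (pmf QS) ss * pr3 n wz (e n m ss) ss zs)) - pr1 n (Q0 QS W x0) zs\<bar>)" for n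
    unfolding L1_def seqs_eq_words by (intro sum.cong refl) (simp add: war Q0n_eq seqs_eq_words)
  \<comment> \<open>Both summands are nonnegative, so the joint bound holds for each of them
    separately.\<close>
  have total: "error_prob QS W n R (enc n) (d n) + L1 n \<le> 23 * \<kappa> ^ n" for n
    unfolding err L1 by (rule bound)
  have L1_0: "0 \<le> L1 n" for n by (simp add: L1_def sum_nonneg)
  have err_le: "error_prob QS W n R (enc n) (d n) \<le> 23 * \<kappa> ^ n" for n
    using total[of n] L1_0[of n] by linarith
  have L1_le: "L1 n \<le> 23 * \<kappa> ^ n" for n
    using total[of n] error_prob_nonneg[of QS W n R "enc n" "d n"] by linarith
  have "(\<lambda>n. 23 * \<kappa> ^ n) \<longlonglongrightarrow> 23 * 0" using \<kappa> by (intro tendsto_intros LIMSEQ_power_zero) auto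
  then have lim: "(\<lambda>n. 23 * \<kappa> ^ n) \<longlonglongrightarrow> 0" by simp
  have "(\<lambda>n. error_prob QS W n R (enc n) (d n)) \<longlonglongrightarrow> 0"
    by (rule tendsto_sandwich[OF always_eventually always_eventually tendsto_const lim])
       (simp_all add: error_prob_nonneg err_le)
  moreover have "(\<lambda>n. KL_seq n (warden_dist QS W n R (enc n)) (Q0n QS W x0)) \<longlonglongrightarrow> 0"
    using L1_le unfolding L1_def by (intro KL_seq_warden_tendsto_0[OF Q0 \<kappa>])
  moreover have "valid_code n R (enc n)" for n
    unfolding valid_code_def seqs_eq_words
    using words_length[OF e] by (auto simp: enc_def words_def)
  ultimately show ?thesis
    unfolding achievable_def by (intro exI[of _ enc] exI[of _ d]) auto
qed

text \<open>In supremum form every single rate in \<open>rate_set\<close> is bounded, hence a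
  maximum as well, and an empty \<open>rate_set\<close> gives the bottom element.\<close>

theorem theorem5:
  fixes QS :: "'s::finite pmf"
    and W :: "'x::finite \<Rightarrow> 's \<Rightarrow> ('y::finite \<times> 'z::finite) pmf"
    and x0 :: 'x
  assumes "\<forall>z. Q0 QS W x0 z > 0"
  shows "(SUP R\<in>rate_set QS W x0. ereal R) \<le> covert_capacity QS W x0"
proof (rule SUP_least)
  have upper: "ereal R \<le> covert_capacity QS W x0" if "achievable QS W x0 R" for R
    unfolding covert_capacity_def using that by (intro Sup_upper) auto
  fix R assume "R \<in> rate_set QS W x0"
  then obtain PU xf where D: "in_D QS W x0 PU xf" and R: "0 \<le> R" "R \<le> I_UY QS W PU xf - I_US QS W PU xf"
    by (auto simp: rate_set_def)
  show "ereal R \<le> covert_capacity QS W x0"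
  \<comment> \<open>A positive rate can be lowered by \<open>4 * \<gamma>\<close> and stay
    nonnegative; rate 0 leaves no such room and has its own code.\<close>
  proof (cases "R = 0")
    case True
    then show ?thesis using upper[OF achievable_0[OF assms]] by simp
  next
    case False
    define d where "d = I_UY QS W PU xf - I_UZ QS W PU xf"
    have d: "0 < d" using D by (simp add: d_def in_D_def)
    show ?thesis
    proof (rule ereal_le_epsilon2)
      fix \<epsilon> :: real assume \<epsilon>: "0 < \<epsilon>"
      \<comment> \<open>\<open>\<epsilon> / 4\<close> keeps the rate loss
        \<open>4 * \<gamma>\<close> within \<open>\<epsilon>\<close>, \<open>d / 6\<close> ensures
        \<open>5 * \<gamma> < d\<close> strictly, and \<open>R / 4\<close> keeps the reduced rate
        nonnegative.\<close>
      define \<gamma> where "\<gamma> = min (min (\<epsilon> / 4) (d / 6)) (R / 4)"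
      have \<gamma>: "0 < \<gamma>" "4 * \<gamma> \<le> \<epsilon>" "5 * \<gamma> < d" "4 * \<gamma> \<le> R"
        using \<epsilon> d R False by (auto simp: \<gamma>_def min_def)
      define R' where "R' = I_UY QS W PU xf - I_US QS W PU xf - 4 * \<gamma>"
      have "achievable QS W x0 R'"
        using \<gamma> R by (intro achievable_below[OF assms D, of \<gamma>]) (auto simp: R'_def d_def)
      from upper[OF this] have "ereal R' + ereal \<epsilon> \<le> covert_capacity QS W x0 + ereal \<epsilon>"
        by (rule add_right_mono)
      moreover have "ereal R \<le> ereal R' + ereal \<epsilon>" using R \<gamma> by (simp add: R'_def)
      ultimately show "ereal R \<le> covert_capacity QS W x0 + ereal \<epsilon>" by (rule order.trans[rotated])
    qed
  qed
qed

end
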